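(* Let $T>0$, $a\in\mathbb{R}$, $\sigma>0$ and $H\in(\tfrac12,1)$. Let $B^H=(B^H_t)_{t\in[0,T]}$ be a fractional Brownian motion with Hurst index $H$ and let $$F=\int_0^T e^{as+\sigma B^H_s}\,ds .$$ Let $\rho_F$ denote the density of the law of $F$ (with respect to Lebesgue measure). Then there exists a positive constant $c$ (not depending on $x$) such that $$\rho_F(x)\leq \frac{c}{x}\exp\left(-\frac{(\ln x-E[\ln F])^2}{2\sigma^2T^{2H}}\right)\quad\text{for all } x> e^{E[\ln F]}.$$
   Context: A fractional Brownian motion with Hurst index $H\in(0,1)$ on $[0,T]$ is a centered Gaussian process $B^H=(B^H_t)_{t\in[0,T]}$ (with continuous paths) with covariance $E[B^H_tB^H_s]=\frac12\left(t^{2H}+s^{2H}-|t-s|^{2H}\right)$, $0\le s,t\le T$. The existence of the density $\rho_F$ is part of the assertion; as usual, the density is understood up to the choice of a version. *)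

theory Defs
  imports "HOL-Probability.Probability"
begin

text \<open>Gaussian laws may be degenerate: for a fractional Brownian motion the variable at
  time 0 is almost surely 0, so point masses must be allowed here.\<close>

definition gaussian_rv :: "'w measure \<Rightarrow> ('w \<Rightarrow> real) \<Rightarrow> bool" where
  "gaussian_rv M X \<longleftrightarrow> X \<in> borel_measurable M \<and>
     (\<exists>\<mu>. (AE \<omega> in M. X \<omega> = \<mu>) \<or>
          (\<exists>s>0. distributed M lborel X (\<lambda>x. ennreal (normal_density \<mu> s x))))"

definition gaussian_process :: "'w measure \<Rightarrow> 'i set \<Rightarrow> ('i \<Rightarrow> 'w \<Rightarrow> real) \<Rightarrow> bool" where
  "gaussian_process M I X \<longleftrightarrow>
     (\<forall>S c. finite S \<and> S \<subseteq> I \<longrightarrow> gaussian_rv M (\<lambda>\<omega>. \<Sum>t\<in>S. c t * X t \<omega>))"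

text \<open>Continuity is required of every path, not just of almost every path. Values of
  \<open>B t\<close> for \<open>t\<close> outside \<open>{0..T}\<close> are unconstrained. At \<open>0\<close> the convention
  \<open>0 powr p = 0\<close> gives the intended covariance.\<close>

definition fractional_brownian_motion ::
    "'w measure \<Rightarrow> real \<Rightarrow> real \<Rightarrow> (real \<Rightarrow> 'w \<Rightarrow> real) \<Rightarrow> bool" where
  "fractional_brownian_motion M T H B \<longleftrightarrow>
     prob_space M \<and>
     gaussian_process M {0..T} B \<and>
     (\<forall>t\<in>{0..T}. integral\<^sup>L M (B t) = 0) \<and>
     (\<forall>t\<in>{0..T}. \<forall>s\<in>{0..T}. integral\<^sup>L M (\<lambda>\<omega>. B t \<omega> * B s \<omega>) =
        (t powr (2 * H) + s powr (2 * H) - \<bar>t - s\<bar> powr (2 * H)) / 2) \<and>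
     (\<forall>\<omega>\<in>space M. continuous_on {0..T} (\<lambda>t. B t \<omega>))"

end

theory Submission
  imports Defs
begin

text \<open>Write \<open>\<tau> = T\<^sup>2\<^sup>H\<close>, \<open>v = \<sigma>\<^sup>2\<tau>\<close> and \<open>N = B T\<close>. The claimed bound has the Gaussian rate
\<open>v\<close>, which is the largest variance of \<open>\<sigma> B s\<close>, but it is not tight. For \<open>ln F\<close> to be large, \<open>N\<close>
must be large, and then \<open>exp (\<sigma> B s)\<close> is close to its maximum only on a time interval near \<open>T\<close> whose
length is of order \<open>1 / N\<close>. So \<open>ln F\<close> behaves like \<open>\<sigma> N - ln N\<close>, and the density at \<open>x = e\<^sup>y\<close> carries
an extra factor of order \<open>exp (- (y ln y) / v)\<close>. This factor beats every \<open>exp (K y)\<close>; in particular it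
absorbs the shift of the Gaussian to \<open>E[ln F]\<close>. So it is enough to bound the density with the right
quadratic term, the gain \<open>y ln y\<close>, and errors that are at most linear in \<open>y\<close> in the exponent.

The density is controlled by moving only \<open>N\<close>. Put \<open>r s = E[B s N] / \<tau>\<close>; the bridge
\<open>W s = B s - r s N\<close> is uncorrelated with \<open>N\<close>, hence the whole process \<open>W\<close> is independent of
\<open>N\<close> (\<open>endpoint_bridge_independent\<close>; the argument applies one-dimensional Levy
uniqueness to signed weights, one coordinate at a time). With \<open>W\<close> frozen, \<open>F = G(N)\<close> for a smooth
increasing function \<open>G\<close> with \<open>G' n = \<sigma> \<integral> r s exp (a s + \<sigma> W s + \<sigma> r s n) ds\<close>. As \<open>0 \<le> r \<le> 1\<close>,
both \<open>G'\<close> and the Gaussian density change by controlled factors when \<open>n\<close> is moved by at most 1.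
Averaging over such a window and substituting \<open>x = G n\<close> shows that the law of \<open>F\<close> is
dominated by \<open>\<kappa> x dx\<close>, where \<open>\<kappa> x = E[L(N) / G'(N); F \<ge> x]\<close> and \<open>L\<close> grows exponentially in \<open>\<bar>N\<bar>\<close>
(\<open>window_bound\<close>, \<open>law_dominated\<close>). In particular the law is absolutely continuous.

It remains to bound \<open>\<kappa>\<close> (\<open>kappa_bound\<close>). The reciprocal of \<open>G'(N)\<close> is at most a constant times
\<open>\<integral> exp (- a t - \<sigma> B t) dt\<close>. If \<open>w\<close> is a subprobability density on \<open>[0, T]\<close>, then \<open>F \<ge> x\<close> forces
\<open>\<integral> (exp (a s + \<sigma> B s) / (x w s))\<^sup>p w s ds \<ge> 1\<close>, by convexity of the power. After these two
replacements only Gaussian exponential moments remain. Since \<open>s\<^sup>2\<^sup>H \<le> \<tau> s / T\<close>, which is where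
\<open>H > 1/2\<close> enters, the exponential weight \<open>w s = \<beta> p exp (- \<beta> p (T - s))\<close> with \<open>\<beta> = v / (2 T)\<close> gives
\<open>\<kappa> x \<le> C x\<^sup>-\<^sup>p (\<beta> p)\<^sup>1\<^sup>-\<^sup>p exp (A p + p\<^sup>2 v / 2)\<close> for every integer \<open>p \<ge> 1\<close>. The
factor \<open>p\<^sup>-\<^sup>p\<close> is the gain announced above; choosing \<open>p\<close> near \<open>(ln x - E[ln F]) / v\<close> finishes the proof
(\<open>superexponential_absorbs\<close>).\<close>

section \<open>Centered Gaussian random variables\<close>

lemma (in prob_space) centered_gaussian_cases:
  assumes "gaussian_rv M Y" "expectation Y = 0"
  obtains (degenerate) "AE \<omega> in M. Y \<omega> = 0"
    | (normal) s where "s > 0" "distributed M lborel Y (\<lambda>x. ennreal (normal_density 0 s x))"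
proof -
  from assms(1) obtain \<mu> where Y: "Y \<in> borel_measurable M" and
    \<mu>: "(AE \<omega> in M. Y \<omega> = \<mu>) \<or> (\<exists>s>0. distributed M lborel Y (\<lambda>x. ennreal (normal_density \<mu> s x)))"
    unfolding gaussian_rv_def by blast
  from \<mu> show ?thesis
  proof
    assume *: "AE \<omega> in M. Y \<omega> = \<mu>"
    have "expectation Y = expectation (\<lambda>_. \<mu>)"
      by (rule integral_cong_AE) (use * Y in auto)
    with assms(2) have "\<mu> = 0" by (simp add: prob_space)
    with * show ?thesis using degenerate by blast
  next
    assume "\<exists>s>0. distributed M lborel Y (\<lambda>x. ennreal (normal_density \<mu> s x))"
    then obtain s where s: "s > 0" "distributed M lborel Y (\<lambda>x. ennreal (normal_density \<mu> s x))" by blast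
    from normal_distributed_expectation[OF s] assms(2) have "\<mu> = 0" by simp
    with s show ?thesis using normal by blast
  qed
qed

lemma (in prob_space) centered_gaussian_square_integrable:
  assumes "gaussian_rv M Y" "expectation Y = 0"
  shows "integrable M (\<lambda>\<omega>. (Y \<omega>)\<^sup>2)"
  using assms
proof (cases rule: centered_gaussian_cases)
  case degenerate
  have [measurable]: "Y \<in> borel_measurable M" using assms(1) by (simp add: gaussian_rv_def)
  have "integrable M (\<lambda>\<omega>. (Y \<omega>)\<^sup>2) \<longleftrightarrow> integrable M (\<lambda>\<omega>. 0::real)"
    by (rule integrable_cong_AE) (use degenerate in auto)
  then show ?thesis by simp
next
  case (normal s)
  have "integrable lborel (\<lambda>x. normal_density 0 s x * x\<^sup>2)"
    using integrable_normal_moment[OF normal(1), of 0 2] by simp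
  then show ?thesis
    using distributed_integrable[OF normal(2), of "\<lambda>x. x\<^sup>2"] by simp
qed

lemma (in prob_space) centered_gaussian_variance:
  assumes "s > 0" "distributed M lborel Y (\<lambda>x. ennreal (normal_density 0 s x))"
  shows "expectation (\<lambda>\<omega>. (Y \<omega>)\<^sup>2) = s\<^sup>2"
  using normal_distributed_variance[OF assms] normal_distributed_expectation[OF assms] by simp

lemma (in prob_space) centered_gaussian_mgf:
  assumes "gaussian_rv M Y" "expectation Y = 0"
  shows "integrable M (\<lambda>\<omega>. exp (Y \<omega>))"
    and "expectation (\<lambda>\<omega>. exp (Y \<omega>)) = exp (expectation (\<lambda>\<omega>. (Y \<omega>)\<^sup>2) / 2)"
proof -
  have [measurable]: "Y \<in> borel_measurable M" using assms(1) by (simp add: gaussian_rv_def)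
  have "integrable M (\<lambda>\<omega>. exp (Y \<omega>)) \<and>
    expectation (\<lambda>\<omega>. exp (Y \<omega>)) = exp (expectation (\<lambda>\<omega>. (Y \<omega>)\<^sup>2) / 2)"
    using assms
  proof (cases rule: centered_gaussian_cases)
    case degenerate
    have 1: "integrable M (\<lambda>\<omega>. exp (Y \<omega>)) \<longleftrightarrow> integrable M (\<lambda>\<omega>. 1::real)"
      by (rule integrable_cong_AE) (use degenerate in auto)
    have 2: "expectation (\<lambda>\<omega>. exp (Y \<omega>)) = expectation (\<lambda>\<omega>. 1)"
      by (rule integral_cong_AE) (use degenerate in auto)
    have 3: "expectation (\<lambda>\<omega>. (Y \<omega>)\<^sup>2) = expectation (\<lambda>\<omega>. 0)"
      by (rule integral_cong_AE) (use degenerate in auto)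
    show ?thesis unfolding 2 3 using 1 by (simp add: prob_space)
  next
    case (normal s)
    \<comment> \<open>completing the square\<close>
    have eq: "normal_density 0 s x * exp x = exp (s\<^sup>2 / 2) * normal_density (s\<^sup>2) s x" for x
    proof -
      have "exp (- (x\<^sup>2 / (2 * s\<^sup>2))) * exp x = exp (s\<^sup>2 / 2) * exp (- ((x - s\<^sup>2)\<^sup>2 / (2 * s\<^sup>2)))"
        using normal(1) unfolding exp_add[symmetric]
        by (simp add: field_simps power2_eq_square)
      then show ?thesis unfolding normal_density_def by simp
    qed
    have "integrable lborel (\<lambda>x. normal_density 0 s x * exp x)"
      unfolding eq using normal(1) by simp
    moreover have "(\<integral>x. normal_density 0 s x * exp x \<partial>lborel) = exp (s\<^sup>2 / 2)"
      unfolding eq using normal(1) by simp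
    ultimately show ?thesis
      using distributed_integrable[OF normal(2), of exp] distributed_integral[OF normal(2), of exp]
        centered_gaussian_variance[OF normal] by simp
  qed
  then show "integrable M (\<lambda>\<omega>. exp (Y \<omega>))"
    and "expectation (\<lambda>\<omega>. exp (Y \<omega>)) = exp (expectation (\<lambda>\<omega>. (Y \<omega>)\<^sup>2) / 2)" by auto
qed

lemma (in prob_space) centered_gaussian_cos_sin:
  assumes "gaussian_rv M Y" "expectation Y = 0"
  shows "expectation (\<lambda>\<omega>. cos (Y \<omega>)) = exp (- expectation (\<lambda>\<omega>. (Y \<omega>)\<^sup>2) / 2)"
    and "expectation (\<lambda>\<omega>. sin (Y \<omega>)) = 0"
proof -
  have [measurable]: "Y \<in> borel_measurable M" using assms(1) by (simp add: gaussian_rv_def)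
  have "expectation (\<lambda>\<omega>. cos (Y \<omega>)) = exp (- expectation (\<lambda>\<omega>. (Y \<omega>)\<^sup>2) / 2) \<and>
    expectation (\<lambda>\<omega>. sin (Y \<omega>)) = 0"
    using assms
  proof (cases rule: centered_gaussian_cases)
    case degenerate
    have 1: "expectation (\<lambda>\<omega>. sin (Y \<omega>)) = expectation (\<lambda>\<omega>. 0)"
      by (rule integral_cong_AE) (use degenerate in auto)
    have 2: "expectation (\<lambda>\<omega>. cos (Y \<omega>)) = expectation (\<lambda>\<omega>. 1)"
      by (rule integral_cong_AE) (use degenerate in auto)
    have 3: "expectation (\<lambda>\<omega>. (Y \<omega>)\<^sup>2) = expectation (\<lambda>\<omega>. 0)"
      by (rule integral_cong_AE) (use degenerate in auto)
    show ?thesis unfolding 1 2 3 by (simp add: prob_space)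
  next
    case (normal s)
    let ?N = "std_normal_distribution"
    interpret N: real_distribution ?N by (rule real_dist_normal_dist)
    have Z: "distributed M lborel (\<lambda>\<omega>. Y \<omega> / s) (\<lambda>x. ennreal (std_normal_density x))"
      using normal normal_standard_normal_convert[OF normal(1), of Y 0] by simp
    have int: "integrable ?N (\<lambda>x. iexp (s * x))"
      by (rule N.integrable_const_bound[where B = 1]) (auto simp: measurable_completion)
    have ch: "(CLINT x|?N. iexp (s * x)) = complex_of_real (exp (- s\<^sup>2 / 2))"
      using fun_cong[OF char_std_normal_distribution, of s] by (simp add: char_def)
    have c: "(\<integral>x. cos (s * x) \<partial>?N) = exp (- s\<^sup>2 / 2)"
      using integral_Re[OF int] ch by (simp add: Re_exp)
    have sn: "(\<integral>x. sin (s * x) \<partial>?N) = 0"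
      using integral_Im[OF int] ch by (simp add: Im_exp)
    have push: "expectation (\<lambda>\<omega>. h (Y \<omega>)) = (\<integral>x. h (s * x) \<partial>?N)"
      if [measurable]: "h \<in> borel_measurable borel" for h :: "real \<Rightarrow> real"
    proof -
      have "(\<integral>x. h (s * x) \<partial>?N) = (\<integral>x. std_normal_density x * h (s * x) \<partial>lborel)"
        by (subst integral_density) auto
      also have "\<dots> = expectation (\<lambda>\<omega>. h (s * (Y \<omega> / s)))"
        by (rule distributed_integral[OF Z, of "\<lambda>x. h (s * x)"]) auto
      finally show ?thesis using normal(1) by simp
    qed
    show ?thesis using push[of cos] push[of sin] c sn centered_gaussian_variance[OF normal] by simp
  qed
  then show "expectation (\<lambda>\<omega>. cos (Y \<omega>)) = exp (- expectation (\<lambda>\<omega>. (Y \<omega>)\<^sup>2) / 2)"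
    and "expectation (\<lambda>\<omega>. sin (Y \<omega>)) = 0" by auto
qed

section \<open>Independence from trigonometric moments\<close>

lemma (in real_distribution) char_eq_cos_sin:
  "char M t = Complex (\<integral>x. cos (t * x) \<partial>M) (\<integral>x. sin (t * x) \<partial>M)"
proof -
  have int: "integrable M (\<lambda>x. iexp (t * x))"
    by (rule integrable_const_bound[where B = 1]) auto
  show ?thesis
    using integral_Re[OF int] integral_Im[OF int]
    by (simp add: complex_eq_iff char_def Re_exp Im_exp)
qed

lemma (in prob_space) integrable_bounded_mult:
  fixes g h :: "'a \<Rightarrow> real"
  assumes "g \<in> borel_measurable M" "h \<in> borel_measurable M"
    "\<And>\<omega>. \<omega> \<in> space M \<Longrightarrow> \<bar>g \<omega>\<bar> \<le> C" "\<And>\<omega>. \<bar>h \<omega>\<bar> \<le> 1"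
  shows "integrable M (\<lambda>\<omega>. g \<omega> * h \<omega>)"
proof (rule integrable_const_bound[where B = C])
  show "AE \<omega> in M. norm (g \<omega> * h \<omega>) \<le> C"
  proof (rule AE_I2)
    fix \<omega> assume "\<omega> \<in> space M"
    then have "\<bar>g \<omega>\<bar> * \<bar>h \<omega>\<bar> \<le> C * 1"
      using assms(3)[of \<omega>] assms(4)[of \<omega>] by (intro mult_mono) auto
    then show "norm (g \<omega> * h \<omega>) \<le> C" by (simp add: abs_mult)
  qed
qed (use assms in auto)

text \<open>A bounded weight \<open>g\<close> with \<open>\<bar>g\<bar> \<le> K\<close> and mean 0 makes \<open>(1 + g / K) dP\<close> a probability measure. If \<open>g\<close> is
orthogonal to all \<open>cos (u V)\<close> and \<open>sin (u V)\<close>, then \<open>V\<close> has the same characteristic function under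
this measure as under \<open>P\<close>, so Levy's theorem applies to signed weights.\<close>

lemma (in prob_space) signed_Levy_uniqueness:
  fixes g V :: "'a \<Rightarrow> real"
  assumes [measurable]: "g \<in> borel_measurable M" "V \<in> borel_measurable M"
    and bd: "\<And>\<omega>. \<omega> \<in> space M \<Longrightarrow> \<bar>g \<omega>\<bar> \<le> C"
    and c0: "\<And>u. expectation (\<lambda>\<omega>. g \<omega> * cos (u * V \<omega>)) = 0"
    and s0: "\<And>u. expectation (\<lambda>\<omega>. g \<omega> * sin (u * V \<omega>)) = 0"
    and A[measurable]: "A \<in> sets borel"
  shows "expectation (\<lambda>\<omega>. g \<omega> * indicator A (V \<omega>)) = 0"
proof -
  \<comment> \<open>positive also for \<open>g = 0\<close> and \<open>C = 0\<close>\<close>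
  define K where "K = C + 1"
  obtain \<omega>0 where "\<omega>0 \<in> space M" using not_empty by blast
  from bd[OF this] have K: "K > 0" unfolding K_def by linarith
  have gK: "\<bar>g \<omega>\<bar> \<le> K" if "\<omega> \<in> space M" for \<omega> using bd[OF that] by (simp add: K_def)
  have nn: "0 \<le> 1 + g \<omega> / K" if "\<omega> \<in> space M" for \<omega>
    using gK[OF that] K by (simp add: field_simps abs_le_iff)
  define P where "P = density M (\<lambda>\<omega>. ennreal (1 + g \<omega> / K))"
  have int: "integrable M (\<lambda>\<omega>. g \<omega> * h (V \<omega>))"
    if "h \<in> borel_measurable borel" "\<And>x. \<bar>h x\<bar> \<le> 1" for h :: "real \<Rightarrow> real"
    by (rule integrable_bounded_mult[where C = C]) (use that bd in \<open>auto intro: measurable_compose\<close>)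
  have int1: "integrable M (\<lambda>\<omega>. h (V \<omega>))"
    if "h \<in> borel_measurable borel" "\<And>x. \<bar>h x\<bar> \<le> 1" for h :: "real \<Rightarrow> real"
    by (rule integrable_const_bound[where B = 1]) (use that in \<open>auto intro: measurable_compose\<close>)
  have key: "(\<integral>\<omega>. h (V \<omega>) \<partial>P) =
      expectation (\<lambda>\<omega>. h (V \<omega>)) + expectation (\<lambda>\<omega>. g \<omega> * h (V \<omega>)) / K"
    if [measurable]: "h \<in> borel_measurable borel" and h: "\<And>x. \<bar>h x\<bar> \<le> 1" for h :: "real \<Rightarrow> real"
  proof -
    have "(\<integral>\<omega>. h (V \<omega>) \<partial>P) = expectation (\<lambda>\<omega>. (1 + g \<omega> / K) * h (V \<omega>))"
      unfolding P_def by (subst integral_density) (auto intro: nn)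
    also have "\<dots> = expectation (\<lambda>\<omega>. h (V \<omega>) + (g \<omega> * h (V \<omega>)) / K)"
      by (simp add: algebra_simps)
    also have "\<dots> = expectation (\<lambda>\<omega>. h (V \<omega>)) + expectation (\<lambda>\<omega>. (g \<omega> * h (V \<omega>)) / K)"
      by (intro Bochner_Integration.integral_add int1 integrable_divide int that)
    finally show ?thesis by simp
  qed
  have [measurable]: "V \<in> borel_measurable P" unfolding P_def by simp
  have g0: "expectation g = 0" using c0[of 0] by simp
  have intg: "integrable M g" by (rule integrable_const_bound[where B = C]) (use bd in auto)
  have "prob_space P"
  proof
    have "emeasure P (space P) = (\<integral>\<^sup>+\<omega>. ennreal (1 + g \<omega> / K) \<partial>M)"
      unfolding P_def by (subst emeasure_density) (auto intro!: nn_integral_cong)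
    also have "\<dots> = ennreal (expectation (\<lambda>\<omega>. 1 + g \<omega> / K))"
      by (rule nn_integral_eq_integral) (use intg nn in auto)
    also have "expectation (\<lambda>\<omega>. 1 + g \<omega> / K) = 1"
      using g0 intg by (simp add: prob_space)
    finally show "emeasure P (space P) = 1" by simp
  qed
  then interpret P: prob_space P .
  let ?M1 = "distr P borel V" and ?M2 = "distr M borel V"
  interpret M1: real_distribution ?M1 by (rule P.real_distribution_distr) simp
  interpret M2: real_distribution ?M2 by (rule real_distribution_distr) simp
  have "char ?M1 = char ?M2"
  proof
    fix t
    show "char ?M1 t = char ?M2 t"
      unfolding M1.char_eq_cos_sin M2.char_eq_cos_sin
      using key[of "\<lambda>x. cos (t * x)"] key[of "\<lambda>x. sin (t * x)"] c0[of t] s0[of t]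
      by (simp add: integral_distr)
  qed
  then have eq: "?M1 = ?M2"
    by (intro Levy_uniqueness M1.real_distribution_axioms M2.real_distribution_axioms)
  have "(\<integral>x. (indicator A x :: real) \<partial>?M1) = (\<integral>x. indicator A x \<partial>?M2)" unfolding eq ..
  then have "(\<integral>\<omega>. (indicator A (V \<omega>) :: real) \<partial>P) = (\<integral>\<omega>. indicator A (V \<omega>) \<partial>M)"
    by (subst (asm) (1 2) integral_distr) auto
  then show ?thesis using key[of "indicator A"] K by (simp add: indicator_def)
qed

text \<open>For a linear space \<open>L\<close> of random variables this says that the signed measure \<open>g dP\<close> has vanishing joint
characteristic function along \<open>L\<close>.\<close>

definition (in prob_space) trig_orthogonal :: "('a \<Rightarrow> real) \<Rightarrow> ('a \<Rightarrow> real) set \<Rightarrow> bool" where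
  "trig_orthogonal g L \<longleftrightarrow> (\<forall>Y\<in>L. expectation (\<lambda>\<omega>. g \<omega> * cos (Y \<omega>)) = 0 \<and>
      expectation (\<lambda>\<omega>. g \<omega> * sin (Y \<omega>)) = 0)"

text \<open>By the product formulas for sine and cosine, \<open>g cos Y\<close> and \<open>g sin Y\<close> are orthogonal to every
\<open>cos (u V)\<close> and \<open>sin (u V)\<close>, so one-dimensional uniqueness inserts the indicator. The conclusion has the
shape of the hypothesis; iterating it yields multivariate uniqueness without any multivariate
inversion formula.\<close>

lemma (in prob_space) trig_orthogonal_indicator:
  fixes g V :: "'a \<Rightarrow> real"
  assumes [measurable]: "g \<in> borel_measurable M" "V \<in> borel_measurable M"
    and bd: "\<And>\<omega>. \<omega> \<in> space M \<Longrightarrow> \<bar>g \<omega>\<bar> \<le> C"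
    and L: "\<And>Y. Y \<in> L \<Longrightarrow> Y \<in> borel_measurable M"
    and clos: "\<And>Y u. Y \<in> L \<Longrightarrow> (\<lambda>\<omega>. Y \<omega> + u * V \<omega>) \<in> L"
    and orth: "trig_orthogonal g L"
    and A[measurable]: "A \<in> sets borel"
  shows "trig_orthogonal (\<lambda>\<omega>. g \<omega> * indicator A (V \<omega>)) L"
  unfolding trig_orthogonal_def
proof
  fix Y assume Y: "Y \<in> L"
  note [measurable] = L[OF Y]
  have bm: "\<bar>g \<omega> * h \<omega>\<bar> \<le> C" if "\<omega> \<in> space M" "\<bar>h \<omega>\<bar> \<le> 1" for h :: "'a \<Rightarrow> real" and \<omega>
  proof -
    have "\<bar>g \<omega>\<bar> * \<bar>h \<omega>\<bar> \<le> C * 1"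
      using bd[OF that(1)] that(2) by (intro mult_mono) auto
    then show ?thesis by (simp add: abs_mult)
  qed
  have int: "integrable M (\<lambda>\<omega>. g \<omega> * h \<omega>)"
    if "h \<in> borel_measurable M" "\<And>\<omega>. \<bar>h \<omega>\<bar> \<le> 1" for h :: "'a \<Rightarrow> real"
    by (rule integrable_bounded_mult[where C = C]) (use that bd in auto)
  have o: "expectation (\<lambda>\<omega>. g \<omega> * cos (Y \<omega> + u * V \<omega>)) = 0"
     "expectation (\<lambda>\<omega>. g \<omega> * sin (Y \<omega> + u * V \<omega>)) = 0" for u
    using orth clos[OF Y, of u] unfolding trig_orthogonal_def by auto
  have m: "expectation (\<lambda>\<omega>. (g \<omega> * h1 \<omega>) * h2 \<omega>) = 0"
    if "\<And>\<omega>. h1 \<omega> * h2 \<omega> = (k1 \<omega> + k2 \<omega>) / 2"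
      "expectation (\<lambda>\<omega>. g \<omega> * k1 \<omega>) = 0" "expectation (\<lambda>\<omega>. g \<omega> * k2 \<omega>) = 0"
      "k1 \<in> borel_measurable M" "\<And>\<omega>. \<bar>k1 \<omega>\<bar> \<le> 1" "k2 \<in> borel_measurable M" "\<And>\<omega>. \<bar>k2 \<omega>\<bar> \<le> 1"
    for h1 h2 k1 k2 :: "'a \<Rightarrow> real"
  proof -
    have "(\<lambda>\<omega>. (g \<omega> * h1 \<omega>) * h2 \<omega>) = (\<lambda>\<omega>. (g \<omega> * k1 \<omega> + g \<omega> * k2 \<omega>) / 2)"
      using that(1) by (auto simp: mult.assoc algebra_simps)
    then show ?thesis using that int by simp
  qed
  have o': "expectation (\<lambda>\<omega>. g \<omega> * - cos (Y \<omega> + u * V \<omega>)) = 0"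
     "expectation (\<lambda>\<omega>. g \<omega> * - sin (Y \<omega> + u * V \<omega>)) = 0" for u
    using o[of u] by simp_all
  have cc: "expectation (\<lambda>\<omega>. (g \<omega> * cos (Y \<omega>)) * cos (u * V \<omega>)) = 0" for u
  proof (rule m[OF _ o(1)[of u] o(1)[of "-u"]])
    fix \<omega>
    show "cos (Y \<omega>) * cos (u * V \<omega>) = (cos (Y \<omega> + u * V \<omega>) + cos (Y \<omega> + (-u) * V \<omega>)) / 2"
      by (simp add: cos_add sin_add cos_diff sin_diff)
  qed auto
  have cs: "expectation (\<lambda>\<omega>. (g \<omega> * cos (Y \<omega>)) * sin (u * V \<omega>)) = 0" for u
  proof (rule m[OF _ o(2)[of u] o'(2)[of "-u"]])
    fix \<omega>
    show "cos (Y \<omega>) * sin (u * V \<omega>) = (sin (Y \<omega> + u * V \<omega>) + - sin (Y \<omega> + (-u) * V \<omega>)) / 2"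
      by (simp add: cos_add sin_add cos_diff sin_diff)
  qed auto
  have sc: "expectation (\<lambda>\<omega>. (g \<omega> * sin (Y \<omega>)) * cos (u * V \<omega>)) = 0" for u
  proof (rule m[OF _ o(2)[of u] o(2)[of "-u"]])
    fix \<omega>
    show "sin (Y \<omega>) * cos (u * V \<omega>) = (sin (Y \<omega> + u * V \<omega>) + sin (Y \<omega> + (-u) * V \<omega>)) / 2"
      by (simp add: cos_add sin_add cos_diff sin_diff)
  qed auto
  have ss: "expectation (\<lambda>\<omega>. (g \<omega> * sin (Y \<omega>)) * sin (u * V \<omega>)) = 0" for u
  proof (rule m[OF _ o(1)[of "-u"] o'(1)[of u]])
    fix \<omega>
    show "sin (Y \<omega>) * sin (u * V \<omega>) = (cos (Y \<omega> + (-u) * V \<omega>) + - cos (Y \<omega> + u * V \<omega>)) / 2"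
      by (simp add: cos_add sin_add cos_diff sin_diff)
  qed auto
  have "expectation (\<lambda>\<omega>. (g \<omega> * cos (Y \<omega>)) * indicator A (V \<omega>)) = 0"
    by (rule signed_Levy_uniqueness[where C = C]) (auto simp: cc cs intro!: bm)
  moreover have "expectation (\<lambda>\<omega>. (g \<omega> * sin (Y \<omega>)) * indicator A (V \<omega>)) = 0"
    by (rule signed_Levy_uniqueness[where C = C]) (auto simp: sc ss intro!: bm)
  ultimately show "expectation (\<lambda>\<omega>. g \<omega> * indicator A (V \<omega>) * cos (Y \<omega>)) = 0 \<and>
     expectation (\<lambda>\<omega>. g \<omega> * indicator A (V \<omega>) * sin (Y \<omega>)) = 0"
    by (simp add: mult.assoc mult.commute mult.left_commute)
qed

lemma (in prob_space) trig_orthogonal_prod_indicator: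
  fixes g :: "'a \<Rightarrow> real" and V :: "'i \<Rightarrow> 'a \<Rightarrow> real"
  assumes "finite J" and [measurable]: "g \<in> borel_measurable M"
    and V: "\<And>j. j \<in> J \<Longrightarrow> V j \<in> borel_measurable M"
    and bd: "\<And>\<omega>. \<omega> \<in> space M \<Longrightarrow> \<bar>g \<omega>\<bar> \<le> C"
    and L: "\<And>Y. Y \<in> L \<Longrightarrow> Y \<in> borel_measurable M"
    and clos: "\<And>Y j u. Y \<in> L \<Longrightarrow> j \<in> J \<Longrightarrow> (\<lambda>\<omega>. Y \<omega> + u * V j \<omega>) \<in> L"
    and orth: "trig_orthogonal g L"
    and A: "\<And>j. j \<in> J \<Longrightarrow> A j \<in> sets borel"
  shows "trig_orthogonal (\<lambda>\<omega>. g \<omega> * (\<Prod>j\<in>J. indicator (A j) (V j \<omega>))) L"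
  using assms(1) V clos A
proof (induction J rule: finite_induct)
  case empty
  then show ?case using orth by simp
next
  case (insert j J)
  have [measurable]: "V i \<in> borel_measurable M" "A i \<in> sets borel" if "i \<in> insert j J" for i
    using insert.prems that by auto
  have ind: "\<bar>\<Prod>j\<in>J. indicator (A j) (V j \<omega>)\<bar> \<le> (1::real)" for \<omega>
    by (simp add: abs_prod prod_le_1)
  have "trig_orthogonal (\<lambda>\<omega>. (g \<omega> * (\<Prod>j\<in>J. indicator (A j) (V j \<omega>))) * indicator (A j) (V j \<omega>)) L"
  proof (rule trig_orthogonal_indicator[where C = C])
    show "trig_orthogonal (\<lambda>\<omega>. g \<omega> * (\<Prod>j\<in>J. indicator (A j) (V j \<omega>))) L"
      by (rule insert.IH) (use insert.prems in auto)
    show "\<bar>g \<omega> * (\<Prod>j\<in>J. indicator (A j) (V j \<omega>))\<bar> \<le> C" if "\<omega> \<in> space M" for \<omega>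
    proof -
      have "\<bar>g \<omega>\<bar> * \<bar>\<Prod>j\<in>J. indicator (A j) (V j \<omega>)\<bar> \<le> C * 1"
        using bd[OF that] ind[of \<omega>] by (intro mult_mono) auto
      then show ?thesis by (simp add: abs_mult)
    qed
  qed (use insert.prems L in auto)
  then show ?case using insert.hyps by (simp add: mult.assoc mult.commute mult.left_commute)
qed

definition (in prob_space) cylinders :: "('i \<Rightarrow> 'a \<Rightarrow> real) \<Rightarrow> 'i set \<Rightarrow> 'a set set" where
  "cylinders V I = {{\<omega>\<in>space M. \<forall>j\<in>J. V j \<omega> \<in> A j} | J A.
      finite J \<and> J \<subseteq> I \<and> (\<forall>j\<in>J. A j \<in> sets borel)}"

text \<open>The sample space with the \<open>\<sigma>\<close>-algebra generated by the process \<open>V\<close>. Keeping the sample space, instead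
of passing to a space of functions, preserves the path regularity of \<open>V\<close>, which a product
\<open>\<sigma>\<close>-algebra cannot see.\<close>

definition (in prob_space) path_space :: "('i \<Rightarrow> 'a \<Rightarrow> real) \<Rightarrow> 'i set \<Rightarrow> 'a measure" where
  "path_space V I = sigma (space M) (cylinders V I)"

lemma (in prob_space) cylinders_Pow: "cylinders V I \<subseteq> Pow (space M)"
  unfolding cylinders_def by auto

lemma (in prob_space) space_path_space [simp]: "space (path_space V I) = space M"
  unfolding path_space_def by (rule space_measure_of[OF cylinders_Pow])

lemma (in prob_space) sets_path_space:
  "sets (path_space V I) = sigma_sets (space M) (cylinders V I)"
  unfolding path_space_def by (rule sets_measure_of[OF cylinders_Pow])

lemma (in prob_space) cylinders_events:
  assumes "\<And>j. j \<in> I \<Longrightarrow> V j \<in> borel_measurable M"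
  shows "cylinders V I \<subseteq> events"
proof
  fix E assume "E \<in> cylinders V I"
  then obtain J A where E: "E = {\<omega>\<in>space M. \<forall>j\<in>J. V j \<omega> \<in> A j}" and J: "finite J" "J \<subseteq> I"
    and [measurable]: "\<And>j. j \<in> J \<Longrightarrow> A j \<in> sets borel"
    unfolding cylinders_def by auto
  have [measurable]: "V j \<in> borel_measurable M" if "j \<in> J" for j using assms J that by auto
  show "E \<in> events" unfolding E using J(1) by measurable
qed

lemma (in prob_space) path_space_measurable:
  assumes "j \<in> I"
  shows "V j \<in> borel_measurable (path_space V I)"
proof (rule measurableI)
  fix A :: "real set" assume "A \<in> sets borel"
  then have "V j -` A \<inter> space M \<in> cylinders V I"
    unfolding cylinders_def using assms by (auto intro!: exI[of _ "{j}"] exI[of _ "\<lambda>_. A"])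
  then show "V j -` A \<inter> space (path_space V I) \<in> sets (path_space V I)"
    by (simp add: sets_path_space)
qed simp

lemma (in prob_space) id_measurable_path_space:
  assumes "\<And>j. j \<in> I \<Longrightarrow> V j \<in> borel_measurable M"
  shows "(\<lambda>\<omega>. \<omega>) \<in> measurable M (path_space V I)"
proof (rule measurableI)
  fix A assume "A \<in> sets (path_space V I)"
  moreover have "sigma_sets (space M) (cylinders V I) \<subseteq> events"
    by (rule sets.sigma_sets_subset[OF cylinders_events[OF assms]])
  ultimately have "A \<in> events" by (auto simp: sets_path_space)
  then show "(\<lambda>\<omega>. \<omega>) -` A \<inter> space M \<in> events" by auto
qed simp

lemma (in prob_space) Int_stable_cylinders: "Int_stable (cylinders V I)"
proof (rule Int_stableI)
  fix E F assume "E \<in> cylinders V I" "F \<in> cylinders V I"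
  then obtain J A K B where
    E: "E = {\<omega>\<in>space M. \<forall>j\<in>J. V j \<omega> \<in> A j}" and J: "finite J" "J \<subseteq> I" "\<And>j. j \<in> J \<Longrightarrow> A j \<in> sets borel" and
    F: "F = {\<omega>\<in>space M. \<forall>j\<in>K. V j \<omega> \<in> B j}" and K: "finite K" "K \<subseteq> I" "\<And>j. j \<in> K \<Longrightarrow> B j \<in> sets borel"
    unfolding cylinders_def by auto
  let ?D = "\<lambda>j. (if j \<in> J then A j else UNIV) \<inter> (if j \<in> K then B j else UNIV)"
  have "E \<inter> F = {\<omega>\<in>space M. \<forall>j\<in>J \<union> K. V j \<omega> \<in> ?D j}" unfolding E F by (auto split: if_splits)
  moreover have "finite (J \<union> K)" "J \<union> K \<subseteq> I" "\<forall>j\<in>J \<union> K. ?D j \<in> sets borel"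
    using J K by auto
  ultimately show "E \<inter> F \<in> cylinders V I"
    unfolding cylinders_def mem_Collect_eq by (intro exI[of _ "J \<union> K"] exI[of _ ?D] conjI)
qed

text \<open>Factorization of the trigonometric moments gives independence of \<open>N\<close> from the whole family \<open>V\<close>. First,
uniqueness in \<open>N\<close> alone shows that \<open>1\<^sub>A(N) - P(N \<in> A)\<close> is trigonometrically orthogonal to \<open>L\<close>; then
the indicators of finitely many \<open>V j\<close> are inserted one at a time. The hypothesis on the sine
moments expresses the symmetry of the variables.\<close>

lemma (in prob_space) distr_Pair_path_space:
  fixes N :: "'a \<Rightarrow> real" and V :: "'i \<Rightarrow> 'a \<Rightarrow> real"
  assumes N[measurable]: "N \<in> borel_measurable M"
    and V: "\<And>j. j \<in> I \<Longrightarrow> V j \<in> borel_measurable M"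
    and L: "\<And>Y. Y \<in> L \<Longrightarrow> Y \<in> borel_measurable M"
    and L0: "(\<lambda>_. 0) \<in> L"
    and clos: "\<And>Y j u. Y \<in> L \<Longrightarrow> j \<in> I \<Longrightarrow> (\<lambda>\<omega>. Y \<omega> + u * V j \<omega>) \<in> L"
    and factor: "\<And>Y u. Y \<in> L \<Longrightarrow> expectation (\<lambda>\<omega>. cos (Y \<omega> + u * N \<omega>)) =
      expectation (\<lambda>\<omega>. cos (Y \<omega>)) * expectation (\<lambda>\<omega>. cos (u * N \<omega>))"
    and odd: "\<And>Y u. Y \<in> L \<Longrightarrow> expectation (\<lambda>\<omega>. sin (Y \<omega> + u * N \<omega>)) = 0"
  shows "distr M (borel \<Otimes>\<^sub>M path_space V I) (\<lambda>\<omega>. (N \<omega>, \<omega>)) =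
    distr M borel N \<Otimes>\<^sub>M distr M (path_space V I) (\<lambda>\<omega>. \<omega>)"
proof -
  have int: "integrable M h"
    if "h \<in> borel_measurable M" "\<And>\<omega>. \<bar>h \<omega>\<bar> \<le> 1" for h :: "'a \<Rightarrow> real"
    by (rule integrable_const_bound[where B = 1]) (use that in auto)
  have step1: "expectation (\<lambda>\<omega>. indicator A (N \<omega>) * cos (Y \<omega>)) = expectation (\<lambda>\<omega>. cos (Y \<omega>)) * expectation (\<lambda>\<omega>. indicator A (N \<omega>))"
    "expectation (\<lambda>\<omega>. indicator A (N \<omega>) * sin (Y \<omega>)) = 0"
    if Y: "Y \<in> L" and A[measurable]: "A \<in> sets borel" for Y and A :: "real set"
  proof -
    note [measurable] = L[OF Y]
    define c where "c = expectation (\<lambda>\<omega>. cos (Y \<omega>))"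
    have "\<bar>c\<bar> \<le> expectation (\<lambda>\<omega>. \<bar>cos (Y \<omega>)\<bar>)" unfolding c_def by (rule integral_abs_bound)
    also have "\<dots> \<le> expectation (\<lambda>_. 1)" by (rule integral_mono) (auto intro!: int)
    finally have c1: "\<bar>c\<bar> \<le> 1" by (simp add: prob_space)
    have bd: "\<bar>cos (Y \<omega>) - c\<bar> \<le> 2" for \<omega>
      using c1 abs_cos_le_one[of "Y \<omega>"] by linarith
    have iY: "integrable M (\<lambda>\<omega>. cos (Y \<omega> + u * N \<omega>))" "integrable M (\<lambda>\<omega>. sin (Y \<omega> + u * N \<omega>))" for u
      by (auto intro!: int)
    have iN: "integrable M (\<lambda>\<omega>. cos (u * N \<omega>))" "integrable M (\<lambda>\<omega>. sin (u * N \<omega>))" for u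
      by (auto intro!: int)
    have N0: "expectation (\<lambda>\<omega>. sin (u * N \<omega>)) = 0" for u using odd[OF L0, of u] by simp
    have "expectation (\<lambda>\<omega>. (cos (Y \<omega>) - c) * indicator A (N \<omega>)) = 0"
    proof (rule signed_Levy_uniqueness[where C = 2])
      fix u
      have e: "(\<lambda>\<omega>. (cos (Y \<omega>) - c) * cos (u * N \<omega>)) =
        (\<lambda>\<omega>. (cos (Y \<omega> + u * N \<omega>) + cos (Y \<omega> + (-u) * N \<omega>)) / 2 - c * cos (u * N \<omega>))"
        by (auto simp: left_diff_distrib cos_times_cos algebra_simps)
      show "expectation (\<lambda>\<omega>. (cos (Y \<omega>) - c) * cos (u * N \<omega>)) = 0"
        unfolding e using iY[of u] iY[of "-u"] iN[of u] factor[OF Y, of u] factor[OF Y, of "-u"]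
        by (simp add: c_def)
      have e: "(\<lambda>\<omega>. (cos (Y \<omega>) - c) * sin (u * N \<omega>)) =
        (\<lambda>\<omega>. (sin (Y \<omega> + u * N \<omega>) - sin (Y \<omega> + (-u) * N \<omega>)) / 2 - c * sin (u * N \<omega>))"
        by (auto simp: left_diff_distrib cos_times_sin algebra_simps)
      show "expectation (\<lambda>\<omega>. (cos (Y \<omega>) - c) * sin (u * N \<omega>)) = 0"
        unfolding e using iY[of u] iY[of "-u"] iN[of u] odd[OF Y, of u] odd[OF Y, of "-u"] N0
        by simp
    qed (use bd in auto)
    moreover have "expectation (\<lambda>\<omega>. (cos (Y \<omega>) - c) * indicator A (N \<omega>)) =
      expectation (\<lambda>\<omega>. indicator A (N \<omega>) * cos (Y \<omega>)) - c * expectation (\<lambda>\<omega>. indicator A (N \<omega>))"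
    proof -
      have e: "(\<lambda>\<omega>. (cos (Y \<omega>) - c) * indicator A (N \<omega>)) =
        (\<lambda>\<omega>. indicator A (N \<omega>) * cos (Y \<omega>) - c * indicator A (N \<omega>))" by (auto simp: algebra_simps)
      have "integrable M (\<lambda>\<omega>. indicator A (N \<omega>) * cos (Y \<omega>))"
        by (rule int) (auto simp: indicator_def)
      moreover have "integrable M (\<lambda>\<omega>. indicator A (N \<omega>) :: real)"
        by (rule int) (auto simp: indicator_def)
      ultimately show ?thesis unfolding e by simp
    qed
    ultimately show "expectation (\<lambda>\<omega>. indicator A (N \<omega>) * cos (Y \<omega>)) =
      expectation (\<lambda>\<omega>. cos (Y \<omega>)) * expectation (\<lambda>\<omega>. indicator A (N \<omega>))" by (simp add: c_def)
    have "expectation (\<lambda>\<omega>. sin (Y \<omega>) * indicator A (N \<omega>)) = 0"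
    proof (rule signed_Levy_uniqueness[where C = 1])
      fix u
      have e: "(\<lambda>\<omega>. sin (Y \<omega>) * cos (u * N \<omega>)) =
        (\<lambda>\<omega>. (sin (Y \<omega> + u * N \<omega>) + sin (Y \<omega> + (-u) * N \<omega>)) / 2)"
        by (auto simp: sin_times_cos algebra_simps)
      show "expectation (\<lambda>\<omega>. sin (Y \<omega>) * cos (u * N \<omega>)) = 0"
        unfolding e using iY[of u] iY[of "-u"] odd[OF Y, of u] odd[OF Y, of "-u"] by simp
      have e: "(\<lambda>\<omega>. sin (Y \<omega>) * sin (u * N \<omega>)) =
        (\<lambda>\<omega>. (cos (Y \<omega> + (-u) * N \<omega>) - cos (Y \<omega> + u * N \<omega>)) / 2)"
        by (auto simp: sin_times_sin algebra_simps)
      show "expectation (\<lambda>\<omega>. sin (Y \<omega>) * sin (u * N \<omega>)) = 0"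
        unfolding e using iY[of u] iY[of "-u"] factor[OF Y, of u] factor[OF Y, of "-u"] by simp
    qed auto
    then show "expectation (\<lambda>\<omega>. indicator A (N \<omega>) * sin (Y \<omega>)) = 0" by (simp add: mult.commute)
  qed
  have step2: "prob ({\<omega>\<in>space M. N \<omega> \<in> A} \<inter> E) = prob {\<omega>\<in>space M. N \<omega> \<in> A} * prob E"
    if A[measurable]: "A \<in> sets borel" and E: "E \<in> cylinders V I" for A E
  proof -
    obtain J B where E: "E = {\<omega>\<in>space M. \<forall>j\<in>J. V j \<omega> \<in> B j}" and J: "finite J" "J \<subseteq> I"
      and [measurable]: "\<And>j. j \<in> J \<Longrightarrow> B j \<in> sets borel"
      using E unfolding cylinders_def by auto
    have [measurable]: "V j \<in> borel_measurable M" if "j \<in> J" for j using V J that by auto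
    have [measurable]: "E \<in> events" unfolding E using J(1) by measurable
    define q :: real where "q = expectation (\<lambda>\<omega>. indicator A (N \<omega>))"
    have iA: "integrable M (\<lambda>\<omega>. indicator A (N \<omega>) :: real)"
      by (rule int) (auto simp: indicator_def)
    have q: "q = prob {\<omega>\<in>space M. N \<omega> \<in> A}"
    proof -
      have "q = expectation (indicator {\<omega>\<in>space M. N \<omega> \<in> A})"
        unfolding q_def by (rule Bochner_Integration.integral_cong) (auto simp: indicator_def)
      then show ?thesis by simp
    qed
    have "0 \<le> q" "q \<le> 1" unfolding q by auto
    have orth: "trig_orthogonal (\<lambda>\<omega>. indicator A (N \<omega>) - q) L"
      unfolding trig_orthogonal_def
    proof
      fix Y assume Y: "Y \<in> L"
      note [measurable] = L[OF Y]
      have i: "integrable M (\<lambda>\<omega>. indicator A (N \<omega>) * cos (Y \<omega>))" "integrable M (\<lambda>\<omega>. indicator A (N \<omega>) * sin (Y \<omega>))"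
        "integrable M (\<lambda>\<omega>. cos (Y \<omega>))" "integrable M (\<lambda>\<omega>. sin (Y \<omega>))"
        by (auto intro!: int simp: indicator_def)
      have "expectation (\<lambda>\<omega>. sin (Y \<omega>)) = 0" using odd[OF Y, of 0] by simp
      then show "expectation (\<lambda>\<omega>. (indicator A (N \<omega>) - q) * cos (Y \<omega>)) = 0 \<and>
          expectation (\<lambda>\<omega>. (indicator A (N \<omega>) - q) * sin (Y \<omega>)) = 0"
        unfolding left_diff_distrib using i step1[OF Y A]
        by (simp add: q_def)
    qed
    have "trig_orthogonal (\<lambda>\<omega>. (indicator A (N \<omega>) - q) * (\<Prod>j\<in>J. indicator (B j) (V j \<omega>))) L"
      by (rule trig_orthogonal_prod_indicator[where C = 1])
        (use J L orth clos \<open>0 \<le> q\<close> \<open>q \<le> 1\<close> in \<open>auto simp: indicator_def\<close>)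
    then have "expectation (\<lambda>\<omega>. (indicator A (N \<omega>) - q) * (\<Prod>j\<in>J. indicator (B j) (V j \<omega>))) = 0"
      using L0 unfolding trig_orthogonal_def by fastforce
    moreover have "(\<Prod>j\<in>J. indicator (B j) (V j \<omega>)) = (indicator E \<omega> :: real)" if "\<omega> \<in> space M" for \<omega>
      unfolding E using J(1) that by (auto simp: indicator_def)
    ultimately have "expectation (\<lambda>\<omega>. (indicator A (N \<omega>) - q) * indicator E \<omega>) = 0"
      by (metis (mono_tags, lifting) Bochner_Integration.integral_cong)
    moreover have "expectation (\<lambda>\<omega>. (indicator A (N \<omega>) - q) * indicator E \<omega>) =
      expectation (\<lambda>\<omega>. indicator ({\<omega>\<in>space M. N \<omega> \<in> A} \<inter> E) \<omega> - q * indicator E \<omega>)"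
      by (rule Bochner_Integration.integral_cong) (auto simp: indicator_def)
    moreover have "\<dots> = prob ({\<omega>\<in>space M. N \<omega> \<in> A} \<inter> E) - q * prob E"
    proof -
      have "{\<omega>\<in>space M. N \<omega> \<in> A} \<inter> E \<in> events" by measurable
      moreover have "integrable M (indicator X :: 'a \<Rightarrow> real)" if "X \<in> events" for X
        using that by (intro int) (auto simp: indicator_def)
      ultimately show ?thesis by (subst Bochner_Integration.integral_diff) auto
    qed
    ultimately show ?thesis unfolding q by simp
  qed
  let ?A = "{N -` A \<inter> space M | A. A \<in> sets borel}"
  have sub: "?A \<subseteq> events" by auto
  have "indep_set ?A (cylinders V I)"
  proof (rule indep_setI[OF sub cylinders_events[OF V]])
    fix a b assume "a \<in> ?A" "b \<in> cylinders V I"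
    then obtain A where A: "A \<in> sets borel" "a = N -` A \<inter> space M" by auto
    have "a = {\<omega>\<in>space M. N \<omega> \<in> A}" using A by auto
    with step2[OF A(1) \<open>b \<in> cylinders V I\<close>] show "prob (a \<inter> b) = prob a * prob b" by simp
  qed
  moreover have "Int_stable ?A"
  proof (rule Int_stableI)
    fix a b assume "a \<in> ?A" "b \<in> ?A"
    then obtain A B where "A \<in> sets borel" "a = N -` A \<inter> space M" "B \<in> sets borel" "b = N -` B \<inter> space M" by auto
    then show "a \<inter> b \<in> ?A" by (auto intro!: exI[of _ "A \<inter> B"])
  qed
  ultimately have ind: "indep_set (sigma_sets (space M) ?A) (sigma_sets (space M) (cylinders V I))"
    by (intro indep_set_sigma_sets Int_stable_cylinders)
  let ?P = "path_space V I"
  have id[measurable]: "(\<lambda>\<omega>. \<omega>) \<in> measurable M ?P" by (rule id_measurable_path_space[OF V])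
  interpret D: prob_space "distr M borel N" by (rule prob_space_distr) simp
  interpret P: prob_space "distr M ?P (\<lambda>\<omega>. \<omega>)" by (rule prob_space_distr) simp
  show ?thesis
  proof (rule pair_measure_eqI[symmetric])
    show "sigma_finite_measure (distr M borel N)" "sigma_finite_measure (distr M ?P (\<lambda>\<omega>. \<omega>))"
      by unfold_locales
    fix A B assume "A \<in> sets (distr M borel N)" "B \<in> sets (distr M ?P (\<lambda>\<omega>. \<omega>))"
    then have A[measurable]: "A \<in> sets borel" and B[measurable]: "B \<in> sets ?P" by simp_all
    have Bs: "B \<subseteq> space M" using sets.sets_into_space[OF B] by simp
    have "B \<in> sigma_sets (space M) (cylinders V I)" using B by (simp add: sets_path_space)
    moreover have "N -` A \<inter> space M \<in> sigma_sets (space M) ?A"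
      by (rule sigma_sets.Basic) (use A in blast)
    ultimately have "prob ((N -` A \<inter> space M) \<inter> B) = prob (N -` A \<inter> space M) * prob B"
      by (intro indep_setD[OF ind])
    moreover have "(\<lambda>\<omega>. (N \<omega>, \<omega>)) -` (A \<times> B) \<inter> space M = (N -` A \<inter> space M) \<inter> B"
      using Bs by auto
    moreover have "(\<lambda>\<omega>. \<omega>) -` B \<inter> space M = B" using Bs by auto
    ultimately show "emeasure (distr M borel N) A * emeasure (distr M ?P (\<lambda>\<omega>. \<omega>)) B =
        emeasure (distr M (borel \<Otimes>\<^sub>M ?P) (\<lambda>\<omega>. (N \<omega>, \<omega>))) (A \<times> B)"
      by (simp add: emeasure_distr emeasure_eq_measure ennreal_mult)
  qed (simp cong: sets_pair_measure_cong)
qed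

lemma (in prob_space) nn_integral_disintegrate:
  assumes id[measurable]: "(\<lambda>\<omega>. \<omega>) \<in> measurable M P"
    and eq: "distr M (borel \<Otimes>\<^sub>M P) (\<lambda>\<omega>. (N \<omega>, \<omega>)) = distr M borel N \<Otimes>\<^sub>M distr M P (\<lambda>\<omega>. \<omega>)"
    and N: "distributed M lborel N f"
    and h[measurable]: "h \<in> borel_measurable (borel \<Otimes>\<^sub>M P)"
  shows "(\<integral>\<^sup>+\<omega>. h (N \<omega>, \<omega>) \<partial>M) = (\<integral>\<^sup>+\<omega>. (\<integral>\<^sup>+n. f n * h (n, \<omega>) \<partial>lborel) \<partial>M)"
proof -
  have [measurable]: "N \<in> borel_measurable M" using distributed_measurable[OF N] by simp
  have [measurable]: "f \<in> borel_measurable borel" using distributed_borel_measurable[OF N] by simp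
  interpret D: prob_space "distr M borel N" by (rule prob_space_distr) simp
  interpret P: prob_space "distr M P (\<lambda>\<omega>. \<omega>)" by (rule prob_space_distr) simp
  interpret DP: pair_sigma_finite "distr M borel N" "distr M P (\<lambda>\<omega>. \<omega>)" ..
  have dN: "distr M borel N = density lborel f"
    using distributed_distr_eq_density[OF N] by (simp cong: distr_cong)
  have "(\<integral>\<^sup>+\<omega>. h (N \<omega>, \<omega>) \<partial>M) = (\<integral>\<^sup>+z. h z \<partial>distr M (borel \<Otimes>\<^sub>M P) (\<lambda>\<omega>. (N \<omega>, \<omega>)))"
    by (subst nn_integral_distr) auto
  also have "\<dots> = (\<integral>\<^sup>+\<omega>. (\<integral>\<^sup>+n. h (n, \<omega>) \<partial>distr M borel N) \<partial>distr M P (\<lambda>\<omega>. \<omega>))"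
    unfolding eq by (rule DP.nn_integral_snd[symmetric]) simp
  also have "\<dots> = (\<integral>\<^sup>+\<omega>. (\<integral>\<^sup>+n. h (n, \<omega>) \<partial>distr M borel N) \<partial>M)"
    by (subst nn_integral_distr) auto
  also have "\<dots> = (\<integral>\<^sup>+\<omega>. (\<integral>\<^sup>+n. f n * h (n, \<omega>) \<partial>lborel) \<partial>M)"
    unfolding dN
  proof (intro nn_integral_cong nn_integral_density)
    fix \<omega> assume "\<omega> \<in> space M"
    then have "\<omega> \<in> space P" using measurable_space[OF id] by auto
    then show "(\<lambda>n. h (n, \<omega>)) \<in> borel_measurable lborel" by simp
  qed simp
  finally show ?thesis .
qed

section \<open>The bridge decomposition of fractional Brownian motion\<close>

text \<open>The notation of the introductory remarks: \<open>R\<close> is the covariance function, \<open>r\<close> the coefficient of the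
regression of \<open>B s\<close> on \<open>B T\<close>, and \<open>W\<close> the bridge that remains.\<close>

locale fbm = prob_space M for M :: "'w measure" +
  fixes T H :: real and B :: "real \<Rightarrow> 'w \<Rightarrow> real"
  assumes T: "T > 0" and H: "1 / 2 < H"
    and fbm: "fractional_brownian_motion M T H B"
begin

definition R :: "real \<Rightarrow> real \<Rightarrow> real" where
  "R s t = (s powr (2 * H) + t powr (2 * H) - \<bar>s - t\<bar> powr (2 * H)) / 2"

definition \<tau> :: real where "\<tau> = T powr (2 * H)"

definition r :: "real \<Rightarrow> real" where "r s = R s T / \<tau>"

definition W :: "real \<Rightarrow> 'w \<Rightarrow> real" where "W s \<omega> = B s \<omega> - r s * B T \<omega>"

lemma tau_pos: "\<tau> > 0" unfolding \<tau>_def using T by simp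

lemma R_diag: "R s s = s powr (2 * H)" unfolding R_def by simp

lemma R_TT: "R T T = \<tau>" unfolding R_diag \<tau>_def ..

lemma r_T: "r T = 1" unfolding r_def R_TT using tau_pos by simp

lemma R_nonneg: "0 \<le> R s t" if "0 \<le> s" "0 \<le> t"
proof -
  have "\<bar>s - t\<bar> powr (2 * H) \<le> (max s t) powr (2 * H)"
    using that H by (intro powr_mono2) auto
  also have "\<dots> \<le> s powr (2 * H) + t powr (2 * H)" by (simp add: max_def)
  finally show ?thesis unfolding R_def by simp
qed

lemma R_le: "R s t \<le> \<tau>" if "s \<in> {0..T}" "t \<in> {0..T}"
proof -
  have "s powr (2 * H) \<le> \<tau>" "t powr (2 * H) \<le> \<tau>"
    unfolding \<tau>_def using that H by (auto intro!: powr_mono2)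
  moreover have "0 \<le> \<bar>s - t\<bar> powr (2 * H)" by simp
  ultimately show ?thesis unfolding R_def by argo
qed

lemma r_nonneg: "0 \<le> r s" if "s \<in> {0..T}"
  unfolding r_def using R_nonneg[of s T] that T tau_pos by simp

lemma r_le_1: "r s \<le> 1" if "s \<in> {0..T}"
  unfolding r_def using R_le[of s T] that T tau_pos by simp

lemma continuous_on_r: "continuous_on {0..T} r"
  unfolding r_def[abs_def] R_def[abs_def] using H tau_pos
  by (intro continuous_on_divide continuous_on_diff continuous_on_add continuous_on_powr'
      continuous_on_const continuous_on_id continuous_on_rabs) auto

text \<open>The size of the Hurst index enters here: the variance of \<open>B s\<close> drops at least linearly
as \<open>s\<close> moves away from \<open>T\<close>, so an exponential weight in \<open>T - s\<close> can compensate it.\<close>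

lemma powr_le_linear: "s powr (2 * H) \<le> \<tau> * s / T" if "s \<in> {0..T}"
proof -
  have "(s / T) powr (2 * H) \<le> (s / T) powr 1"
    using that T H by (intro powr_mono') auto
  moreover have "(s / T) powr (2 * H) = s powr (2 * H) / \<tau>"
    unfolding \<tau>_def using that T by (simp add: powr_divide)
  moreover have "(s / T) powr 1 = s / T" using that T by simp
  ultimately have "s powr (2 * H) / \<tau> \<le> s / T" by simp
  then have "s powr (2 * H) / \<tau> * \<tau> \<le> s / T * \<tau>" using tau_pos by (intro mult_right_mono) auto
  then show ?thesis using tau_pos by (simp add: mult.commute)
qed

definition lin_span :: "('w \<Rightarrow> real) set" where
  "lin_span = {Y. \<exists>S c. finite S \<and> S \<subseteq> {0..T} \<and> Y = (\<lambda>\<omega>. \<Sum>t\<in>S. c t * B t \<omega>)}"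

lemma B_in_span: "t \<in> {0..T} \<Longrightarrow> B t \<in> lin_span"
  unfolding lin_span_def by (auto intro!: exI[of _ "{t}"] exI[of _ "\<lambda>_. 1"])

lemma zero_in_span: "(\<lambda>_. 0) \<in> lin_span"
  unfolding lin_span_def by (auto intro!: exI[of _ "{}"])

lemma span_add_scaled:
  assumes "Y \<in> lin_span" "Z \<in> lin_span"
  shows "(\<lambda>\<omega>. Y \<omega> + u * Z \<omega>) \<in> lin_span"
proof -
  from assms obtain S c S' c' where
    Y: "finite S" "S \<subseteq> {0..T}" "Y = (\<lambda>\<omega>. \<Sum>t\<in>S. c t * B t \<omega>)" and
    Z: "finite S'" "S' \<subseteq> {0..T}" "Z = (\<lambda>\<omega>. \<Sum>t\<in>S'. c' t * B t \<omega>)"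
    unfolding lin_span_def by auto
  define d where "d t = (if t \<in> S then c t else 0) + (if t \<in> S' then u * c' t else 0)" for t
  have "Y \<omega> + u * Z \<omega> = (\<Sum>t\<in>S \<union> S'. d t * B t \<omega>)" for \<omega>
  proof -
    have "Y \<omega> = (\<Sum>t\<in>S \<union> S'. (if t \<in> S then c t else 0) * B t \<omega>)"
      unfolding Y(3) by (rule sum.mono_neutral_cong_left) (use Y Z in auto)
    moreover have "u * Z \<omega> = (\<Sum>t\<in>S \<union> S'. (if t \<in> S' then u * c' t else 0) * B t \<omega>)"
      unfolding Z(3) sum_distrib_left by (rule sum.mono_neutral_cong_left) (use Y Z in auto)
    ultimately show ?thesis by (simp add: d_def distrib_right sum.distrib)
  qed
  then show ?thesis unfolding lin_span_def
    using Y Z by (auto intro!: exI[of _ "S \<union> S'"] exI[of _ d])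
qed

lemma span_scaled: "Z \<in> lin_span \<Longrightarrow> (\<lambda>\<omega>. u * Z \<omega>) \<in> lin_span"
  using span_add_scaled[OF zero_in_span, of Z u] by simp

lemma span_gaussian: "Y \<in> lin_span \<Longrightarrow> gaussian_rv M Y"
  using fbm unfolding fractional_brownian_motion_def gaussian_process_def lin_span_def by auto

lemma span_measurable: "Y \<in> lin_span \<Longrightarrow> Y \<in> borel_measurable M"
  using span_gaussian unfolding gaussian_rv_def by auto

lemma B_measurable: "t \<in> {0..T} \<Longrightarrow> B t \<in> borel_measurable M"
  by (rule span_measurable[OF B_in_span])

lemma B_expectation: "t \<in> {0..T} \<Longrightarrow> expectation (B t) = 0"
  using fbm unfolding fractional_brownian_motion_def by auto

lemma B_square_integrable: "t \<in> {0..T} \<Longrightarrow> integrable M (\<lambda>\<omega>. (B t \<omega>)\<^sup>2)"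
  by (intro centered_gaussian_square_integrable span_gaussian B_in_span B_expectation)

lemma B_integrable: "t \<in> {0..T} \<Longrightarrow> integrable M (B t)"
  by (rule square_integrable_imp_integrable[OF B_measurable B_square_integrable])

lemma span_expectation: "Y \<in> lin_span \<Longrightarrow> expectation Y = 0"
  unfolding lin_span_def
  by (auto simp: B_expectation B_integrable subset_iff)

lemma span_square_integrable: "Y \<in> lin_span \<Longrightarrow> integrable M (\<lambda>\<omega>. (Y \<omega>)\<^sup>2)"
  by (intro centered_gaussian_square_integrable span_gaussian span_expectation)

lemma span_mult_integrable:
  assumes "Y \<in> lin_span" "Z \<in> lin_span"
  shows "integrable M (\<lambda>\<omega>. Y \<omega> * Z \<omega>)"
proof (rule Bochner_Integration.integrable_bound[where f = "\<lambda>\<omega>. (Y \<omega>)\<^sup>2 + (Z \<omega>)\<^sup>2"])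
  show "integrable M (\<lambda>\<omega>. (Y \<omega>)\<^sup>2 + (Z \<omega>)\<^sup>2)"
    using assms by (intro Bochner_Integration.integrable_add span_square_integrable)
  show "(\<lambda>\<omega>. Y \<omega> * Z \<omega>) \<in> borel_measurable M"
    using assms by (intro borel_measurable_times span_measurable)
  have "\<bar>y * z\<bar> \<le> y\<^sup>2 + z\<^sup>2" for y z :: real
  proof -
    have "0 \<le> (\<bar>y\<bar> - \<bar>z\<bar>)\<^sup>2" "0 \<le> y\<^sup>2" "0 \<le> z\<^sup>2" by auto
    then have "2 * \<bar>y * z\<bar> \<le> y\<^sup>2 + z\<^sup>2" by (simp add: power2_diff abs_mult)
    then show ?thesis by linarith
  qed
  then show "AE \<omega> in M. norm (Y \<omega> * Z \<omega>) \<le> norm ((Y \<omega>)\<^sup>2 + (Z \<omega>)\<^sup>2)" by (intro AE_I2) auto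
qed

definition cov :: "('w \<Rightarrow> real) \<Rightarrow> ('w \<Rightarrow> real) \<Rightarrow> real" where
  "cov Y Z = expectation (\<lambda>\<omega>. Y \<omega> * Z \<omega>)"

lemma cov_sym: "cov Y Z = cov Z Y" unfolding cov_def by (simp add: mult.commute)

lemma cov_add_scaled:
  assumes "Y \<in> lin_span" "Z \<in> lin_span" "V \<in> lin_span"
  shows "cov (\<lambda>\<omega>. Y \<omega> + u * Z \<omega>) V = cov Y V + u * cov Z V"
proof -
  have e: "(\<lambda>\<omega>. (Y \<omega> + u * Z \<omega>) * V \<omega>) = (\<lambda>\<omega>. Y \<omega> * V \<omega> + u * (Z \<omega> * V \<omega>))"
    by (auto simp: algebra_simps)
  show ?thesis unfolding cov_def e using assms by (simp add: span_mult_integrable)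
qed

lemma var_add_scaled:
  assumes "Y \<in> lin_span" "Z \<in> lin_span"
  shows "cov (\<lambda>\<omega>. Y \<omega> + u * Z \<omega>) (\<lambda>\<omega>. Y \<omega> + u * Z \<omega>) = cov Y Y + 2 * u * cov Y Z + u\<^sup>2 * cov Z Z"
proof -
  let ?S = "\<lambda>\<omega>. Y \<omega> + u * Z \<omega>"
  have "cov ?S ?S = cov Y ?S + u * cov Z ?S"
    using assms by (intro cov_add_scaled span_add_scaled)
  also have "cov Y ?S = cov Y Y + u * cov Y Z"
    using cov_add_scaled[OF assms(1,2) assms(1), of u] by (simp add: cov_sym)
  also have "cov Z ?S = cov Y Z + u * cov Z Z"
    using cov_add_scaled[OF assms(1,2) assms(2), of u] cov_sym[of Z ?S] by simp
  finally show ?thesis by (simp add: algebra_simps power2_eq_square)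
qed

lemma cov_scaled: "cov (\<lambda>\<omega>. u * Z \<omega>) V = u * cov Z V"
  unfolding cov_def by (simp add: mult.assoc)

lemma cov_B: "s \<in> {0..T} \<Longrightarrow> t \<in> {0..T} \<Longrightarrow> cov (B s) (B t) = R s t"
  using fbm unfolding fractional_brownian_motion_def cov_def R_def by auto

lemma T_in: "T \<in> {0..T}" using T by simp

lemmas N_in_span = B_in_span[OF T_in]

lemma span_mgf:
  assumes "Y \<in> lin_span"
  shows "integrable M (\<lambda>\<omega>. exp (Y \<omega>))" "expectation (\<lambda>\<omega>. exp (Y \<omega>)) = exp (cov Y Y / 2)"
  using centered_gaussian_mgf[OF span_gaussian[OF assms] span_expectation[OF assms]]
  unfolding cov_def by (simp_all add: power2_eq_square)

lemma span_cos_sin: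
  assumes "Y \<in> lin_span"
  shows "expectation (\<lambda>\<omega>. cos (Y \<omega>)) = exp (- cov Y Y / 2)" "expectation (\<lambda>\<omega>. sin (Y \<omega>)) = 0"
  using centered_gaussian_cos_sin[OF span_gaussian[OF assms] span_expectation[OF assms]]
  unfolding cov_def by (simp_all add: power2_eq_square)

definition bridge_span :: "('w \<Rightarrow> real) set" where
  "bridge_span = {Y \<in> lin_span. cov Y (B T) = 0}"

lemma W_in_span: "s \<in> {0..T} \<Longrightarrow> W s \<in> lin_span"
  using span_add_scaled[OF B_in_span N_in_span, of s "- r s"] by (simp add: W_def[abs_def])

lemma W_in_bridge_span: assumes "s \<in> {0..T}" shows "W s \<in> bridge_span"
proof -
  have "cov (W s) (B T) = R s T + (- r s) * R T T"
    using cov_add_scaled[OF B_in_span[OF assms] N_in_span N_in_span, of "- r s"] cov_B[OF assms T_in]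
      cov_B[OF T_in T_in] by (simp add: W_def[abs_def])
  then show ?thesis
    using W_in_span[OF assms] tau_pos unfolding bridge_span_def by (simp add: r_def R_TT)
qed

lemma bridge_span_add:
  assumes "Y \<in> bridge_span" "s \<in> {0..T}"
  shows "(\<lambda>\<omega>. Y \<omega> + u * W s \<omega>) \<in> bridge_span"
  using assms W_in_bridge_span[OF assms(2)] cov_add_scaled[of Y "W s" "B T" u] N_in_span
  unfolding bridge_span_def by (simp add: span_add_scaled)

lemma W_measurable: "s \<in> {0..T} \<Longrightarrow> W s \<in> borel_measurable M"
  by (rule span_measurable[OF W_in_span])

abbreviation "bridge_space \<equiv> path_space W {0..T}"

lemma id_measurable_bridge_space: "(\<lambda>\<omega>. \<omega>) \<in> measurable M bridge_space"
  by (rule id_measurable_path_space[OF W_measurable])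

lemma endpoint_bridge_independent:
  "distr M (borel \<Otimes>\<^sub>M bridge_space) (\<lambda>\<omega>. (B T \<omega>, \<omega>)) =
    distr M borel (B T) \<Otimes>\<^sub>M distr M bridge_space (\<lambda>\<omega>. \<omega>)"
proof (rule distr_Pair_path_space[where L = bridge_span])
  fix Y u assume Y: "Y \<in> bridge_span"
  then have Ys: "Y \<in> lin_span" and c: "cov Y (B T) = 0" unfolding bridge_span_def by auto
  have S: "(\<lambda>\<omega>. Y \<omega> + u * B T \<omega>) \<in> lin_span" by (rule span_add_scaled[OF Ys N_in_span])
  have uN: "(\<lambda>\<omega>. u * B T \<omega>) \<in> lin_span" by (rule span_scaled[OF N_in_span])
  have "cov (\<lambda>\<omega>. u * B T \<omega>) (\<lambda>\<omega>. u * B T \<omega>) = u\<^sup>2 * cov (B T) (B T)"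
    unfolding cov_def by (simp add: power2_eq_square mult.assoc mult.left_commute)
  then show "expectation (\<lambda>\<omega>. cos (Y \<omega> + u * B T \<omega>)) =
      expectation (\<lambda>\<omega>. cos (Y \<omega>)) * expectation (\<lambda>\<omega>. cos (u * B T \<omega>))"
    unfolding span_cos_sin[OF S] span_cos_sin[OF Ys] span_cos_sin[OF uN] var_add_scaled[OF Ys N_in_span]
    by (simp add: c exp_add[symmetric] add_divide_distrib)
  show "expectation (\<lambda>\<omega>. sin (Y \<omega> + u * B T \<omega>)) = 0" by (rule span_cos_sin(2)[OF S])
next
  show "(\<lambda>_. 0) \<in> bridge_span"
    unfolding bridge_span_def using zero_in_span by (simp add: cov_def)
qed (use B_measurable[OF T_in] W_measurable bridge_span_add span_measurable in \<open>auto simp: bridge_span_def\<close>)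

lemma endpoint_distributed:
  "distributed M lborel (B T) (\<lambda>x. ennreal (normal_density 0 (sqrt \<tau>) x))"
proof -
  have v: "expectation (\<lambda>\<omega>. (B T \<omega>)\<^sup>2) = \<tau>"
    using cov_B[OF T_in T_in] by (simp add: cov_def R_TT power2_eq_square)
  show ?thesis
    using span_gaussian[OF N_in_span] B_expectation[OF T_in]
  proof (cases rule: centered_gaussian_cases)
    case degenerate
    have "expectation (\<lambda>\<omega>. (B T \<omega>)\<^sup>2) = expectation (\<lambda>_. 0)"
      by (rule integral_cong_AE) (use degenerate B_measurable[OF T_in] in auto)
    with v tau_pos show ?thesis by simp
  next
    case (normal s)
    with centered_gaussian_variance[OF normal] v have "s = sqrt \<tau>" by (simp add: real_sqrt_unique)
    with normal show ?thesis by simp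
  qed
qed

lemma disintegrate_endpoint:
  assumes "h \<in> borel_measurable (borel \<Otimes>\<^sub>M bridge_space)"
  shows "(\<integral>\<^sup>+\<omega>. h (B T \<omega>, \<omega>) \<partial>M) =
    (\<integral>\<^sup>+\<omega>. (\<integral>\<^sup>+n. ennreal (normal_density 0 (sqrt \<tau>) n) * h (n, \<omega>) \<partial>lborel) \<partial>M)"
  by (rule nn_integral_disintegrate[OF id_measurable_bridge_space endpoint_bridge_independent
        endpoint_distributed assms])

text \<open>Only the variance of \<open>p \<sigma> B s\<close> contributes a term quadratic in \<open>p\<close>. Because \<open>0 \<le> R \<le> \<tau>\<close>, the covariance with
\<open>- \<sigma> B t\<close> is at most 0 and the one with \<open>\<epsilon> B T / \<tau>\<close> adds at most a term linear in \<open>p\<close>.\<close>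

lemma mgf_bound:
  assumes s: "s \<in> {0..T}" and t: "t \<in> {0..T}" and "\<sigma> > 0" and \<epsilon>: "\<bar>\<epsilon>\<bar> \<le> 1"
  shows "(\<integral>\<^sup>+\<omega>. ennreal (exp (real p * \<sigma> * B s \<omega> - \<sigma> * B t \<omega> + \<epsilon> / \<tau> * B T \<omega>)) \<partial>M)
    \<le> ennreal (exp ((real p)\<^sup>2 * \<sigma>\<^sup>2 * s powr (2 * H) / 2 + real p * \<sigma> + (\<sigma>\<^sup>2 * \<tau> + 2 * \<sigma> + 1 / \<tau>) / 2))"
proof -
  let ?X = "\<lambda>\<omega>. (- \<sigma>) * B t \<omega>"
  let ?Z = "\<lambda>\<omega>. ?X \<omega> + (\<epsilon> / \<tau>) * B T \<omega>"
  let ?Y = "\<lambda>\<omega>. ?Z \<omega> + (real p * \<sigma>) * B s \<omega>"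
  have [simp]: "\<tau> > 0" "\<tau> \<noteq> 0" using tau_pos by auto
  have X: "?X \<in> lin_span" by (rule span_scaled[OF B_in_span[OF t]])
  have Z: "?Z \<in> lin_span" by (rule span_add_scaled[OF X N_in_span])
  have Y: "?Y \<in> lin_span" by (rule span_add_scaled[OF Z B_in_span[OF s]])
  have XX: "cov ?X ?X = \<sigma>\<^sup>2 * R t t"
    using cov_B[OF t t] by (simp add: cov_def power2_eq_square mult.assoc mult.left_commute)
  have XN: "cov ?X (B T) = - \<sigma> * R t T"
    using cov_scaled[of "- \<sigma>" "B t" "B T"] cov_B[OF t T_in] by simp
  have ZZ: "cov ?Z ?Z = \<sigma>\<^sup>2 * R t t + 2 * (\<epsilon> / \<tau>) * (- \<sigma> * R t T) + (\<epsilon> / \<tau>)\<^sup>2 * \<tau>"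
    unfolding var_add_scaled[OF X N_in_span] XX XN by (simp add: cov_B[OF T_in T_in] R_TT)
  have ZB: "cov ?Z (B s) = - \<sigma> * R t s + (\<epsilon> / \<tau>) * R T s"
    unfolding cov_add_scaled[OF X N_in_span B_in_span[OF s]]
    using cov_scaled[of "- \<sigma>" "B t" "B s"] cov_B[OF t s] cov_B[OF T_in s] by simp
  have e1: "(\<epsilon> / \<tau>) * R T s \<le> 1"
  proof -
    have "(\<epsilon> / \<tau>) * R T s \<le> (1 / \<tau>) * R T s"
      using \<epsilon> R_nonneg[of T s] s T by (intro mult_right_mono divide_right_mono) (auto simp: less_imp_le)
    also have "\<dots> \<le> (1 / \<tau>) * \<tau>"
      using R_le[OF T_in s] by (intro mult_left_mono) (auto simp: less_imp_le)
    finally show ?thesis by simp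
  qed
  have e2: "- (\<epsilon> / \<tau>) * R t T \<le> 1"
  proof -
    have "- (\<epsilon> / \<tau>) * R t T \<le> (1 / \<tau>) * R t T"
      using \<epsilon> R_nonneg[of t T] t T by (intro mult_right_mono) (auto simp: field_simps)
    also have "\<dots> \<le> (1 / \<tau>) * \<tau>"
      using R_le[OF t T_in] by (intro mult_left_mono) (auto simp: less_imp_le)
    finally show ?thesis by simp
  qed
  have e3: "(\<epsilon> / \<tau>)\<^sup>2 * \<tau> \<le> 1 / \<tau>"
  proof -
    have "\<epsilon>\<^sup>2 \<le> 1" using \<epsilon> by (simp add: abs_square_le_1)
    then have "\<epsilon>\<^sup>2 / \<tau> \<le> 1 / \<tau>" by (intro divide_right_mono) (auto simp: less_imp_le)
    then show ?thesis by (simp add: power_divide power2_eq_square)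
  qed
  have zz: "cov ?Z ?Z \<le> \<sigma>\<^sup>2 * \<tau> + 2 * \<sigma> + 1 / \<tau>"
  proof -
    have "2 * (\<epsilon> / \<tau>) * (- \<sigma> * R t T) = 2 * \<sigma> * (- (\<epsilon> / \<tau>) * R t T)" by simp
    also have "\<dots> \<le> 2 * \<sigma> * 1" using e2 assms(3) by (intro mult_left_mono) auto
    finally have "2 * (\<epsilon> / \<tau>) * (- \<sigma> * R t T) \<le> 2 * \<sigma>" by simp
    moreover have "\<sigma>\<^sup>2 * R t t \<le> \<sigma>\<^sup>2 * \<tau>" using R_le[OF t t] by (intro mult_left_mono) auto
    ultimately show ?thesis unfolding ZZ using e3 by linarith
  qed
  have zb: "2 * (real p * \<sigma>) * cov ?Z (B s) \<le> 2 * (real p * \<sigma>) * 1"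
  proof (rule mult_left_mono)
    have "0 \<le> \<sigma> * R t s" using R_nonneg[of t s] s t assms(3) by simp
    then show "cov ?Z (B s) \<le> 1" unfolding ZB using e1 by linarith
  qed (use assms(3) in auto)
  have "cov ?Y ?Y \<le> (real p)\<^sup>2 * \<sigma>\<^sup>2 * s powr (2 * H) + 2 * (real p * \<sigma>) + (\<sigma>\<^sup>2 * \<tau> + 2 * \<sigma> + 1 / \<tau>)"
    unfolding var_add_scaled[OF Z B_in_span[OF s]] cov_B[OF s s] R_diag
    using zz zb by (simp add: power_mult_distrib)
  then have le: "cov ?Y ?Y / 2 \<le> (real p)\<^sup>2 * \<sigma>\<^sup>2 * s powr (2 * H) / 2 + real p * \<sigma> + (\<sigma>\<^sup>2 * \<tau> + 2 * \<sigma> + 1 / \<tau>) / 2"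
    by argo
  have "(\<integral>\<^sup>+\<omega>. ennreal (exp (real p * \<sigma> * B s \<omega> - \<sigma> * B t \<omega> + \<epsilon> / \<tau> * B T \<omega>)) \<partial>M)
    = (\<integral>\<^sup>+\<omega>. ennreal (exp (?Y \<omega>)) \<partial>M)" by (simp add: algebra_simps)
  also have "\<dots> = ennreal (exp (cov ?Y ?Y / 2))"
    unfolding span_mgf(2)[OF Y, symmetric] by (rule nn_integral_eq_integral[OF span_mgf(1)[OF Y]]) simp
  also have "\<dots> \<le> ennreal (exp ((real p)\<^sup>2 * \<sigma>\<^sup>2 * s powr (2 * H) / 2 + real p * \<sigma> + (\<sigma>\<^sup>2 * \<tau> + 2 * \<sigma> + 1 / \<tau>) / 2))"
    using le by (intro ennreal_leI) simp
  finally show ?thesis .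
qed

end

section \<open>Exponential integrals over an interval\<close>

lemma ennreal_set_integral_Icc:
  fixes g :: "real \<Rightarrow> real"
  assumes "continuous_on {0..T} g" "\<And>s. s \<in> {0..T} \<Longrightarrow> 0 \<le> g s"
  shows "ennreal (LINT s:{0..T}|lborel. g s) = (\<integral>\<^sup>+s. ennreal (g s) * indicator {0..T} s \<partial>lborel)"
proof -
  have "integrable lborel (\<lambda>s. indicator {0..T} s *\<^sub>R g s)"
    using borel_integrable_atLeastAtMost'[OF assms(1)] unfolding set_integrable_def .
  then have "(\<integral>\<^sup>+s. ennreal (indicator {0..T} s *\<^sub>R g s) \<partial>lborel) = ennreal (LINT s:{0..T}|lborel. g s)"
    unfolding set_lebesgue_integral_def
    by (rule nn_integral_eq_integral) (use assms(2) in \<open>auto split: split_indicator\<close>)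
  moreover have "(\<integral>\<^sup>+s. ennreal (indicator {0..T} s *\<^sub>R g s) \<partial>lborel) =
      (\<integral>\<^sup>+s. ennreal (g s) * indicator {0..T} s \<partial>lborel)"
    by (rule nn_integral_cong) (auto split: split_indicator)
  ultimately show ?thesis by simp
qed

lemma set_lebesgue_integral_pos_Icc:
  fixes g :: "real \<Rightarrow> real"
  assumes "continuous_on {0..T} g" "0 < T" "\<And>s. s \<in> {0..T} \<Longrightarrow> 0 \<le> g s" "0 < g T"
  shows "0 < (LINT s:{0..T}|lborel. g s)"
proof -
  note i = borel_integrable_atLeastAtMost'[OF assms(1)]
  have "integral {0..T} g \<noteq> 0"
    using integral_eq_0_iff[OF assms(1,2,3)] assms(2,4) by force
  moreover have "0 \<le> integral {0..T} g"
    using set_borel_integral_eq_integral(1)[OF i] assms(3) by (rule integral_nonneg)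
  ultimately show ?thesis unfolding set_borel_integral_eq_integral(2)[OF i] by simp
qed

text \<open>The Cauchy--Schwarz inequality \<open>(\<integral> q)\<^sup>2 \<le> \<integral> q e \<integral> q / e\<close>, obtained by integrating
\<open>q (1 - l e)\<^sup>2 / e \<ge> 0\<close> for the optimal constant \<open>l\<close>. It replaces a reciprocal of an integral, whose
expectation has no closed form, by an integral of reciprocals.\<close>

lemma inverse_integral_le:
  fixes q e :: "real \<Rightarrow> real"
  assumes T: "0 < T" and q: "continuous_on {0..T} q" "\<And>s. s \<in> {0..T} \<Longrightarrow> 0 \<le> q s" "0 < q T"
    and e: "continuous_on {0..T} e" "\<And>s. s \<in> {0..T} \<Longrightarrow> 0 < e s"
  shows "1 / (LINT s:{0..T}|lborel. q s * e s) \<le>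
    (LINT s:{0..T}|lborel. q s / e s) / (LINT s:{0..T}|lborel. q s)\<^sup>2"
proof -
  define Q D where "Q = (LINT s:{0..T}|lborel. q s)" and "D = (LINT s:{0..T}|lborel. q s * e s)"
  define l where "l = Q / D"
  have Q: "Q > 0" unfolding Q_def by (rule set_lebesgue_integral_pos_Icc[OF q(1) T q(2,3)])
  have D: "D > 0" unfolding D_def
    by (rule set_lebesgue_integral_pos_Icc) (use T q e in \<open>auto intro!: continuous_intros mult_nonneg_nonneg simp: less_imp_le\<close>)
  have [simp]: "set_integrable lborel {0..T} q" by (rule borel_integrable_atLeastAtMost'[OF q(1)])
  have [simp]: "set_integrable lborel {0..T} (\<lambda>s. q s * e s)"
    by (rule borel_integrable_atLeastAtMost') (use q e in \<open>auto intro!: continuous_intros\<close>)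
  have [simp]: "set_integrable lborel {0..T} (\<lambda>s. q s / e s)"
    by (rule borel_integrable_atLeastAtMost') (use q e in \<open>force intro!: continuous_intros\<close>)
  have "(LINT s:{0..T}|lborel. 2 * l * q s - l\<^sup>2 * (q s * e s)) \<le> (LINT s:{0..T}|lborel. q s / e s)"
  proof (rule set_integral_mono)
    fix s assume s: "s \<in> {0..T}"
    have "0 \<le> q s / e s * (1 - l * e s)\<^sup>2" using q(2)[OF s] e(2)[OF s] by simp
    also have "\<dots> = q s / e s - (2 * l * q s - l\<^sup>2 * (q s * e s))"
      using e(2)[OF s] by (simp add: field_simps power2_eq_square)
    finally show "2 * l * q s - l\<^sup>2 * (q s * e s) \<le> q s / e s" by simp
  qed simp_all
  also have "(LINT s:{0..T}|lborel. 2 * l * q s - l\<^sup>2 * (q s * e s)) = 2 * l * Q - l\<^sup>2 * D"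
    unfolding Q_def D_def by (subst set_integral_diff) simp_all
  also have "\<dots> = Q\<^sup>2 / D" unfolding l_def using D by (simp add: field_simps power2_eq_square)
  finally show ?thesis unfolding Q_def[symmetric] D_def[symmetric] using Q D by (simp add: field_simps)
qed

text \<open>A Markov inequality with a free weight: with \<open>u = e / (x w)\<close>, Bernoulli's inequality
\<open>u\<^sup>p \<ge> 1 + p (u - 1)\<close> is integrated against \<open>w\<close>.\<close>

lemma one_le_weighted_power_integral:
  fixes e w :: "real \<Rightarrow> real"
  assumes e: "continuous_on {0..T} e" "\<And>s. s \<in> {0..T} \<Longrightarrow> 0 < e s"
    and w: "continuous_on {0..T} w" "\<And>s. s \<in> {0..T} \<Longrightarrow> 0 < w s" "(LINT s:{0..T}|lborel. w s) \<le> 1"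
    and x: "0 < x" "x \<le> (LINT s:{0..T}|lborel. e s)" and p: "p \<ge> 1"
  shows "1 \<le> (LINT s:{0..T}|lborel. (e s / (x * w s)) ^ p * w s)"
proof -
  have [simp]: "set_integrable lborel {0..T} w" by (rule borel_integrable_atLeastAtMost'[OF w(1)])
  have [simp]: "set_integrable lborel {0..T} e" by (rule borel_integrable_atLeastAtMost'[OF e(1)])
  have i: "set_integrable lborel {0..T} (\<lambda>s. (e s / (x * w s)) ^ p * w s)"
    by (rule borel_integrable_atLeastAtMost')
      (use e w x in \<open>auto intro!: continuous_intros dest!: w(2)\<close>)
  have "1 = (1 - real p) * 1 + real p * 1" by simp
  also have "\<dots> \<le> (1 - real p) * (LINT s:{0..T}|lborel. w s) + real p * ((LINT s:{0..T}|lborel. e s) / x)"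
    using w(3) x p by (intro add_mono mult_left_mono_neg mult_left_mono) auto
  also have "\<dots> = (LINT s:{0..T}|lborel. (1 - real p) * w s + real p / x * e s)"
    by (subst set_integral_add) simp_all
  also have "\<dots> \<le> (LINT s:{0..T}|lborel. (e s / (x * w s)) ^ p * w s)"
  proof (rule set_integral_mono[OF _ i])
    fix s assume s: "s \<in> {0..T}"
    define u where "u = e s / (x * w s)"
    have u: "u > 0" unfolding u_def using e(2)[OF s] w(2)[OF s] x(1) by simp
    have "1 + real p * (u - 1) \<le> (1 + (u - 1)) ^ p" by (rule Bernoulli_inequality) (use u in simp)
    then have "(1 + real p * (u - 1)) * w s \<le> u ^ p * w s"
      using w(2)[OF s] by (intro mult_right_mono) auto
    moreover have "(1 + real p * (u - 1)) * w s = (1 - real p) * w s + real p / x * e s"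
      unfolding u_def using w(2)[OF s] x(1) by (simp add: field_simps)
    ultimately show "(1 - real p) * w s + real p / x * e s \<le> (e s / (x * w s)) ^ p * w s"
      by (simp add: u_def)
  qed simp
  finally show ?thesis .
qed

lemma exponential_weight_integral_le_1:
  assumes "0 < T" "0 < k"
  shows "(LINT s:{0..T}|lborel. k * exp (- k * (T - s))) \<le> (1::real)"
proof -
  have "(LINT s:{0..T}|lborel. k * exp (- k * (T - s))) = exp (- k * (T - T)) - exp (- k * (T - 0))"
    unfolding set_lebesgue_integral_def
    by (rule integral_FTC_atLeastAtMost)
      (use assms in \<open>auto intro!: continuous_intros derivative_eq_intros
          simp flip: has_real_derivative_iff_has_vector_derivative\<close>)
  then show ?thesis by simp
qed

lemma normal_density_Harnack:
  assumes "n \<le> z" "z \<le> n + 1" "\<tau> > 0"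
  shows "normal_density 0 (sqrt \<tau>) n \<le> exp (1 / (2 * \<tau>) + \<bar>z\<bar> / \<tau>) * normal_density 0 (sqrt \<tau>) z"
proof -
  have "z\<^sup>2 - n\<^sup>2 = (z - n) * (z + n)" by (simp add: power2_eq_square algebra_simps)
  also have "\<dots> \<le> \<bar>z - n\<bar> * \<bar>z + n\<bar>" by (metis abs_ge_self abs_mult)
  also have "\<dots> \<le> 1 * (1 + 2 * \<bar>z\<bar>)" using assms by (intro mult_mono) auto
  finally have "- n\<^sup>2 \<le> 1 + 2 * \<bar>z\<bar> - z\<^sup>2" by simp
  then have "- n\<^sup>2 / (2 * \<tau>) \<le> (1 + 2 * \<bar>z\<bar> - z\<^sup>2) / (2 * \<tau>)"
    using assms(3) by (intro divide_right_mono) auto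
  also have "\<dots> = (1 / (2 * \<tau>) + \<bar>z\<bar> / \<tau>) + (- z\<^sup>2 / (2 * \<tau>))"
    using assms(3) by (simp add: field_simps)
  finally have "exp (- n\<^sup>2 / (2 * \<tau>)) \<le> exp (1 / (2 * \<tau>) + \<bar>z\<bar> / \<tau>) * exp (- z\<^sup>2 / (2 * \<tau>))"
    unfolding exp_add[symmetric] by simp
  then have "exp (- n\<^sup>2 / (2 * \<tau>)) / sqrt (2 * pi * \<tau>) \<le>
     (exp (1 / (2 * \<tau>) + \<bar>z\<bar> / \<tau>) * exp (- z\<^sup>2 / (2 * \<tau>))) / sqrt (2 * pi * \<tau>)"
    by (rule divide_right_mono) (use assms(3) in simp)
  then show ?thesis unfolding normal_density_def using assms(3) by (simp add: mult_ac)
qed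

text \<open>The functional of one fixed bridge path, as a function \<open>\<Phi>\<close> of the endpoint \<open>n\<close>, and its derivative
\<open>D\<close>.\<close>

locale tilted_integral =
  fixes T \<sigma> :: real and r f :: "real \<Rightarrow> real"
  assumes T: "T > 0" and \<sigma>: "\<sigma> > 0"
    and f: "continuous_on {0..T} f" and r: "continuous_on {0..T} r"
    and r0: "\<And>s. s \<in> {0..T} \<Longrightarrow> 0 \<le> r s" and r1: "\<And>s. s \<in> {0..T} \<Longrightarrow> r s \<le> 1" and rT: "0 < r T"
begin

definition \<Phi> :: "real \<Rightarrow> real" where
  "\<Phi> n = (LINT s:{0..T}|lborel. exp (f s + \<sigma> * r s * n))"

definition D :: "real \<Rightarrow> real" where
  "D n = (LINT s:{0..T}|lborel. \<sigma> * r s * exp (f s + \<sigma> * r s * n))"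

lemma int_Phi: "set_integrable lborel {0..T} (\<lambda>s. exp (f s + \<sigma> * r s * n))"
  by (rule borel_integrable_atLeastAtMost') (intro continuous_intros f r)

lemma int_D: "set_integrable lborel {0..T} (\<lambda>s. \<sigma> * r s * exp (f s + \<sigma> * r s * n))"
  by (rule borel_integrable_atLeastAtMost') (intro continuous_intros f r)

lemma cont2: "continuous_on (UNIV \<times> cbox 0 T) (\<lambda>(n, s). \<sigma> * r s * exp (f s + \<sigma> * r s * n))"
proof -
  have "continuous_on (UNIV \<times> {0..T}) (\<lambda>x. f (snd x))" "continuous_on (UNIV \<times> {0..T}) (\<lambda>x. r (snd x))"
    by (rule continuous_on_compose2[OF f] continuous_on_compose2[OF r]; auto intro!: continuous_intros)+
  then show ?thesis unfolding split_beta cbox_interval by (intro continuous_intros)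
qed

lemma Phi_deriv: "(\<Phi> has_real_derivative D n) (at n)"
proof -
  have "((\<lambda>n. integral (cbox 0 T) (\<lambda>s. exp (f s + \<sigma> * r s * n))) has_real_derivative
      integral (cbox 0 T) (\<lambda>s. \<sigma> * r s * exp (f s + \<sigma> * r s * n))) (at n within UNIV)"
    by (rule leibniz_rule_field_derivative[OF _ _ cont2])
      (auto intro!: derivative_eq_intros integrable_continuous_interval continuous_intros f r)
  then show ?thesis
    unfolding \<Phi>_def[abs_def] D_def set_borel_integral_eq_integral(2)[OF int_Phi]
      set_borel_integral_eq_integral(2)[OF int_D] by simp
qed

lemma continuous_on_D: "continuous_on S D"
proof -
  have "continuous_on UNIV (\<lambda>n. integral (cbox 0 T) (\<lambda>s. \<sigma> * r s * exp (f s + \<sigma> * r s * n)))"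
    by (rule integral_continuous_on_param[OF cont2])
  then show ?thesis
    unfolding D_def[abs_def] set_borel_integral_eq_integral(2)[OF int_D] cbox_interval
    by (rule continuous_on_subset) simp
qed

lemma continuous_on_Phi: "continuous_on S \<Phi>"
  by (rule has_real_derivative_imp_continuous_on) (auto intro: Phi_deriv)

lemma D_pos: "D n > 0"
  unfolding D_def
  by (rule set_lebesgue_integral_pos_Icc) (use T \<sigma> r0 rT f r in \<open>auto intro!: continuous_intros\<close>)

lemma Phi_pos: "\<Phi> n > 0"
  unfolding \<Phi>_def
  by (rule set_lebesgue_integral_pos_Icc) (use T f r in \<open>auto intro!: continuous_intros\<close>)

text \<open>As \<open>0 \<le> r \<le> 1\<close>, the exponent of the integrand grows by at most \<open>\<sigma>\<close> when \<open>n\<close> grows by at most 1.\<close>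

lemma D_Harnack:
  assumes "n \<le> z" "z \<le> n + 1"
  shows "D z \<le> exp \<sigma> * D n"
  unfolding D_def set_integral_mult_right[symmetric]
proof (rule set_integral_mono[OF int_D])
  show "set_integrable lborel {0..T} (\<lambda>s. exp \<sigma> * (\<sigma> * r s * exp (f s + \<sigma> * r s * n)))"
    using int_D by simp
  fix s assume s: "s \<in> {0..T}"
  have "r s * (z - n) \<le> 1 * 1" using r0[OF s] r1[OF s] assms by (intro mult_mono) auto
  then have "\<sigma> * (r s * (z - n)) \<le> \<sigma> * 1" using \<sigma> by (intro mult_left_mono) auto
  then have "exp (f s + \<sigma> * r s * z) \<le> exp (\<sigma> + (f s + \<sigma> * r s * n))" by (simp add: algebra_simps)
  also have "\<dots> = exp \<sigma> * exp (f s + \<sigma> * r s * n)" by (rule exp_add)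
  finally have "\<sigma> * r s * exp (f s + \<sigma> * r s * z) \<le> \<sigma> * r s * (exp \<sigma> * exp (f s + \<sigma> * r s * n))"
    using \<sigma> r0[OF s] by (intro mult_left_mono) auto
  then show "\<sigma> * r s * exp (f s + \<sigma> * r s * z) \<le> exp \<sigma> * (\<sigma> * r s * exp (f s + \<sigma> * r s * n))"
    by (simp add: mult_ac)
qed

text \<open>By the two comparison lemmas, \<open>\<phi> n \<le> D n * (\<phi> z * L z / D z)\<close> whenever \<open>n \<le> z \<le> n + 1\<close>. Integrating
over this window, exchanging the integrals and substituting \<open>x = \<Phi> n\<close> turns the factor \<open>D n\<close> into the
Lebesgue measure. The window stands in for an integration by parts over \<open>[n, \<infinity>)\<close>.\<close>

lemma window_bound:
  fixes \<psi> :: "real \<Rightarrow> ennreal"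
  assumes \<psi>[measurable]: "\<psi> \<in> borel_measurable borel" and \<tau>: "\<tau> > 0"
  defines "\<phi> \<equiv> normal_density 0 (sqrt \<tau>)"
  shows "(\<integral>\<^sup>+n. ennreal (\<phi> n) * \<psi> (\<Phi> n) \<partial>lborel) \<le>
    (\<integral>\<^sup>+z. ennreal (\<phi> z) * (ennreal (exp (\<sigma> + 1 / (2 * \<tau>) + \<bar>z\<bar> / \<tau>) / D z) *
        (\<integral>\<^sup>+x. \<psi> x * indicator {..\<Phi> z} x \<partial>lborel)) \<partial>lborel)"
proof -
  have [measurable]: "\<Phi> \<in> borel_measurable borel" "D \<in> borel_measurable borel"
    by (intro borel_measurable_continuous_onI continuous_on_Phi continuous_on_D)+
  have [measurable]: "\<phi> \<in> borel_measurable borel" unfolding \<phi>_def by simp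
  define g where "g z = \<phi> z * (exp (\<sigma> + 1 / (2 * \<tau>) + \<bar>z\<bar> / \<tau>) / D z)" for z
  have [measurable]: "g \<in> borel_measurable borel" unfolding g_def[abs_def] by measurable
  have g0: "0 \<le> g z" for z unfolding g_def \<phi>_def using D_pos[of z] by simp
  have pt: "\<phi> n \<le> D n * g z" if "n \<le> z" "z \<le> n + 1" for n z
  proof -
    have "\<phi> n * 1 \<le> (exp (1 / (2 * \<tau>) + \<bar>z\<bar> / \<tau>) * \<phi> z) * (exp \<sigma> * D n / D z)"
      using normal_density_Harnack[OF that \<tau>] D_Harnack[OF that] D_pos[of z]
      unfolding \<phi>_def by (intro mult_mono) auto
    also have "\<dots> = D n * g z" unfolding g_def by (simp add: exp_add mult_ac)
    finally show ?thesis by simp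
  qed
  have "(\<integral>\<^sup>+n. ennreal (\<phi> n) * \<psi> (\<Phi> n) \<partial>lborel) =
      (\<integral>\<^sup>+n. (\<integral>\<^sup>+z. ennreal (\<phi> n) * \<psi> (\<Phi> n) * indicator {n..n+1} z \<partial>lborel) \<partial>lborel)"
    by (simp add: nn_integral_cmult)
  also have "\<dots> \<le> (\<integral>\<^sup>+n. (\<integral>\<^sup>+z. ennreal (g z) * (\<psi> (\<Phi> n) * ennreal (D n) * indicator {z-1..z} n) \<partial>lborel) \<partial>lborel)"
  proof (intro nn_integral_mono)
    fix n z
    show "ennreal (\<phi> n) * \<psi> (\<Phi> n) * indicator {n..n+1} z \<le>
        ennreal (g z) * (\<psi> (\<Phi> n) * ennreal (D n) * indicator {z-1..z} n)"
    proof (cases "n \<le> z \<and> z \<le> n + 1")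
      case True
      then have "ennreal (\<phi> n) \<le> ennreal (D n * g z)" by (intro ennreal_leI pt) auto
      also have "\<dots> = ennreal (D n) * ennreal (g z)"
        by (rule ennreal_mult) (use D_pos[of n] g0 in auto)
      finally have "ennreal (\<phi> n) * \<psi> (\<Phi> n) \<le> ennreal (D n) * ennreal (g z) * \<psi> (\<Phi> n)"
        by (rule mult_right_mono) simp
      then show ?thesis using True by (simp add: mult_ac)
    qed auto
  qed
  also have "\<dots> = (\<integral>\<^sup>+z. (\<integral>\<^sup>+n. ennreal (g z) * (\<psi> (\<Phi> n) * ennreal (D n) * indicator {z-1..z} n) \<partial>lborel) \<partial>lborel)"
  proof (rule lborel_pair.Fubini')
    have "(\<lambda>x. ennreal (g (fst x)) * (\<psi> (\<Phi> (snd x)) * ennreal (D (snd x)) *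
        (if fst x - 1 \<le> snd x \<and> snd x \<le> fst x then 1 else 0))) \<in> borel_measurable (lborel \<Otimes>\<^sub>M lborel)"
      by measurable
    then show "(\<lambda>(z, n). ennreal (g z) * (\<psi> (\<Phi> n) * ennreal (D n) * indicator {z-1..z} n))
        \<in> borel_measurable (lborel \<Otimes>\<^sub>M lborel)"
      by (simp add: split_beta indicator_def of_bool_def)
  qed
  also have "\<dots> = (\<integral>\<^sup>+z. ennreal (g z) * (\<integral>\<^sup>+n. \<psi> (\<Phi> n) * ennreal (D n) * indicator {z-1..z} n \<partial>lborel) \<partial>lborel)"
    by (simp add: nn_integral_cmult)
  also have "\<dots> = (\<integral>\<^sup>+z. ennreal (g z) * (\<integral>\<^sup>+x. \<psi> x * indicator {\<Phi> (z-1)..\<Phi> z} x \<partial>lborel) \<partial>lborel)"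
    by (subst nn_integral_substitution_aux[OF \<psi> _ Phi_deriv continuous_on_D])
      (auto simp: less_imp_le[OF D_pos])
  also have "\<dots> \<le> (\<integral>\<^sup>+z. ennreal (g z) * (\<integral>\<^sup>+x. \<psi> x * indicator {..\<Phi> z} x \<partial>lborel) \<partial>lborel)"
    by (intro nn_integral_mono mult_left_mono) (auto split: split_indicator)
  also have "\<dots> = (\<integral>\<^sup>+z. ennreal (\<phi> z) * (ennreal (exp (\<sigma> + 1 / (2 * \<tau>) + \<bar>z\<bar> / \<tau>) / D z) *
        (\<integral>\<^sup>+x. \<psi> x * indicator {..\<Phi> z} x \<partial>lborel)) \<partial>lborel)"
  proof (intro nn_integral_cong)
    fix z
    have "ennreal (g z) = ennreal (\<phi> z) * ennreal (exp (\<sigma> + 1 / (2 * \<tau>) + \<bar>z\<bar> / \<tau>) / D z)"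
      unfolding g_def by (rule ennreal_mult) (use D_pos[of z] in \<open>auto simp: \<phi>_def\<close>)
    then show "ennreal (g z) * (\<integral>\<^sup>+x. \<psi> x * indicator {..\<Phi> z} x \<partial>lborel) =
      ennreal (\<phi> z) * (ennreal (exp (\<sigma> + 1 / (2 * \<tau>) + \<bar>z\<bar> / \<tau>) / D z) *
        (\<integral>\<^sup>+x. \<psi> x * indicator {..\<Phi> z} x \<partial>lborel))" by (simp add: mult_ac)
  qed
  finally show ?thesis .
qed

end

section \<open>Superexponential absorption and dominated laws\<close>

text \<open>Take the integer \<open>p\<close> with \<open>p - 2 \<le> (ln x - m) / v \<le> p - 1\<close>. Then the terms quadratic in \<open>p\<close> cancel,
and the difference of the two exponents is at most a constant plus \<open>(p - 1) (L - ln p)\<close> for a constant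
\<open>L\<close>. This is bounded in \<open>p\<close>.\<close>

lemma superexponential_absorbs:
  fixes A C \<beta> v m :: real
  assumes "C > 0" "\<beta> > 0" "v > 0"
  obtains c where "c > 0"
    "\<And>x. x > exp m \<Longrightarrow> \<exists>p\<ge>1. C * (\<beta> * real p) * exp (real p * A + (real p)\<^sup>2 * v / 2) / (x * (\<beta> * real p)) ^ p
        \<le> c / x * exp (- ((ln x - m)\<^sup>2 / (2 * v)))"
proof -
  define L where "L = A + v - m - ln \<beta>"
  define K where "K = exp L * \<bar>L\<bar>"
  define c where "c = exp (ln C + (A + v) + K)"
  have bounded: "(real p - 1) * (L - ln (real p)) \<le> K" if "p \<ge> 1" for p :: nat
  proof (cases "L \<le> ln (real p)")
    case True
    then have "(real p - 1) * (L - ln (real p)) \<le> 0" using that by (intro mult_nonneg_nonpos) auto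
    then show ?thesis unfolding K_def by (meson abs_ge_zero exp_ge_zero mult_nonneg_nonneg order_trans)
  next
    case False
    have "real p = exp (ln (real p))" using that by simp
    also have "\<dots> \<le> exp L" using False by simp
    finally have "real p - 1 \<le> exp L" by simp
    moreover have "L - ln (real p) \<le> \<bar>L\<bar>" using that ln_ge_zero[of "real p"] by linarith
    ultimately show ?thesis unfolding K_def using False by (intro mult_mono) auto
  qed
  have "\<exists>p\<ge>1. C * (\<beta> * real p) * exp (real p * A + (real p)\<^sup>2 * v / 2) / (x * (\<beta> * real p)) ^ p
        \<le> c / x * exp (- ((ln x - m)\<^sup>2 / (2 * v)))" if xm: "x > exp m" for x
  proof -
    have x: "x > 0" using xm exp_gt_zero[of m] by linarith
    have ym: "ln x > m" using xm x by (metis exp_less_cancel_iff exp_ln)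
    define q where "q = (ln x - m) / v"
    define p where "p = nat \<lceil>q\<rceil> + 1"
    define d where "d = real p - q"
    have q: "q > 0" unfolding q_def using ym assms(3) by simp
    have p1: "p \<ge> 1" unfolding p_def by simp
    have "real p = real_of_int \<lceil>q\<rceil> + 1" unfolding p_def using q by (simp add: of_nat_nat)
    then have d: "1 \<le> d" "d \<le> 2" unfolding d_def by linarith+
    have y: "ln x = m + v * (real p - d)" unfolding d_def q_def using assms(3) by simp
    have bp: "\<beta> * real p > 0" using assms(2) p1 by simp
    have lbp: "ln (\<beta> * real p) = ln \<beta> + ln (real p)" using assms(2) p1 by (simp add: ln_mult)
    have pow: "(x * (\<beta> * real p)) ^ p = exp (real p * (ln x + ln (\<beta> * real p)))"
      using x bp by (simp add: exp_of_nat_mult exp_add)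
    have lhs: "C * (\<beta> * real p) * exp (real p * A + (real p)\<^sup>2 * v / 2) / (x * (\<beta> * real p)) ^ p =
        exp (ln C + ln (\<beta> * real p) + (real p * A + (real p)\<^sup>2 * v / 2) - real p * (ln x + ln (\<beta> * real p)))"
      unfolding pow exp_diff exp_add using assms(1) bp by simp
    have rhs: "c / x * exp (- ((ln x - m)\<^sup>2 / (2 * v))) = exp (ln C + (A + v) + K - ln x - (ln x - m)\<^sup>2 / (2 * v))"
      unfolding c_def exp_diff using x by (simp add: exp_minus field_simps)
    have sq: "(ln x - m)\<^sup>2 / (2 * v) = v * (real p - d)\<^sup>2 / 2"
      unfolding y using assms(3) by (simp add: power2_eq_square field_simps)
    have dd: "v * (d * (d - 2)) \<le> 0"
      using d assms(3) by (intro mult_nonneg_nonpos) auto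
    have "ln C + ln (\<beta> * real p) + (real p * A + (real p)\<^sup>2 * v / 2) - real p * (ln x + ln (\<beta> * real p))
        + ln x + (ln x - m)\<^sup>2 / (2 * v)
      = ln C + (A + v) + (real p - 1) * (L - ln (real p)) + v * (d * (d - 2)) / 2"
      unfolding sq lbp unfolding y L_def by (simp add: power2_eq_square field_simps)
    then have "ln C + ln (\<beta> * real p) + (real p * A + (real p)\<^sup>2 * v / 2) - real p * (ln x + ln (\<beta> * real p))
        \<le> ln C + (A + v) + K - ln x - (ln x - m)\<^sup>2 / (2 * v)"
      using bounded[OF p1] dd by linarith
    then have "C * (\<beta> * real p) * exp (real p * A + (real p)\<^sup>2 * v / 2) / (x * (\<beta> * real p)) ^ p
        \<le> c / x * exp (- ((ln x - m)\<^sup>2 / (2 * v)))"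
      unfolding lhs rhs by simp
    with p1 show ?thesis by blast
  qed
  moreover have "c > 0" unfolding c_def by simp
  ultimately show ?thesis using that by blast
qed

text \<open>Lebesgue null sets are null for the law because the integral of \<open>k\<close> over them vanishes. On \<open>S\<close> the
Radon--Nikodym density can exceed \<open>b\<close> only on a null set, and the version \<open>\<rho>\<close> is cut off there.\<close>

lemma (in prob_space) density_of_dominated_law:
  fixes X :: "'a \<Rightarrow> real" and k :: "real \<Rightarrow> ennreal" and b :: "real \<Rightarrow> real"
  assumes X[measurable]: "X \<in> borel_measurable M"
    and dom: "\<And>A. A \<in> sets borel \<Longrightarrow> emeasure M {\<omega>\<in>space M. X \<omega> \<in> A} \<le> (\<integral>\<^sup>+x. indicator A x * k x \<partial>lborel)"
    and S[measurable]: "S \<in> sets borel" and b[measurable]: "b \<in> borel_measurable borel"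
    and b0: "\<And>x. x \<in> S \<Longrightarrow> 0 \<le> b x" and kb: "\<And>x. x \<in> S \<Longrightarrow> k x \<le> ennreal (b x)"
  obtains \<rho> :: "real \<Rightarrow> real" where "\<And>x. 0 \<le> \<rho> x" "distributed M lborel X (\<lambda>x. ennreal (\<rho> x))"
    "\<And>x. x \<in> S \<Longrightarrow> \<rho> x \<le> b x"
proof -
  let ?N = "distr M lborel X"
  have em: "emeasure ?N A = emeasure M {\<omega>\<in>space M. X \<omega> \<in> A}" if "A \<in> sets borel" for A
    using that by (subst emeasure_distr) (auto intro!: arg_cong2[where f = emeasure])
  interpret N: prob_space ?N by (rule prob_space_distr) simp
  have "absolutely_continuous lborel ?N"
    unfolding absolutely_continuous_def
  proof
    fix A :: "real set" assume A: "A \<in> null_sets lborel"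
    then have A'[measurable]: "A \<in> sets borel" by auto
    have "(\<integral>\<^sup>+x. indicator A x * k x \<partial>lborel) = (\<integral>\<^sup>+(x::real). 0 \<partial>lborel)"
      by (rule nn_integral_cong_AE) (use AE_not_in[OF A] in \<open>auto split: split_indicator\<close>)
    then have "emeasure ?N A = 0" using dom[OF A'] em[OF A'] by simp
    then show "A \<in> null_sets ?N" by auto
  qed
  then obtain f where f[measurable]: "f \<in> borel_measurable lborel" and dens: "density lborel f = ?N"
    using sigma_finite_measure.Radon_Nikodym[OF sigma_finite_lborel, of ?N] by auto
  have law: "emeasure ?N A = (\<integral>\<^sup>+x. f x * indicator A x \<partial>lborel)" if "A \<in> sets borel" for A
    unfolding dens[symmetric] using that by (simp add: emeasure_density)
  have "(\<integral>\<^sup>+x. f x \<partial>lborel) = emeasure ?N UNIV" using law[of UNIV] by simp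
  also have "\<dots> \<le> 1" by (rule N.emeasure_le_1)
  finally have "(\<integral>\<^sup>+x. f x \<partial>lborel) \<noteq> \<infinity>" by (auto simp: top_unique)
  then have fin: "AE x in lborel. f x \<noteq> \<infinity>" by (rule nn_integral_PInf_AE[OF f])
  define A where "A = {x\<in>S. ennreal (b x) < f x}"
  have A[measurable]: "A \<in> sets borel"
  proof -
    have "{x\<in>space borel. x \<in> S \<and> ennreal (b x) < f x} \<in> sets borel" using f by measurable
    then show ?thesis unfolding A_def by simp
  qed
  have "AE x in lborel. x \<notin> A"
  proof -
    let ?f = "\<lambda>x. f x * indicator A x" and ?b = "\<lambda>x. ennreal (b x) * indicator A x"
    have le: "?b x \<le> ?f x" for x unfolding A_def by (auto split: split_indicator)
    have "(\<integral>\<^sup>+x. ?f x \<partial>lborel) = emeasure ?N A" using law[OF A] by simp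
    also have "\<dots> \<le> (\<integral>\<^sup>+x. indicator A x * k x \<partial>lborel)" using dom[OF A] em[OF A] by simp
    also have "\<dots> \<le> (\<integral>\<^sup>+x. ?b x \<partial>lborel)"
      by (rule nn_integral_mono) (auto simp: A_def kb split: split_indicator)
    finally have fb: "(\<integral>\<^sup>+x. ?f x \<partial>lborel) \<le> (\<integral>\<^sup>+x. ?b x \<partial>lborel)" .
    have "(\<integral>\<^sup>+x. ?b x \<partial>lborel) \<le> (\<integral>\<^sup>+x. ?f x \<partial>lborel)" by (rule nn_integral_mono) (rule le)
    also have "\<dots> = emeasure ?N A" using law[OF A] by simp
    also have "\<dots> \<le> 1" by (rule N.emeasure_le_1)
    finally have bfin: "(\<integral>\<^sup>+x. ?b x \<partial>lborel) \<noteq> \<infinity>" by (auto simp: top_unique)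
    then have "(\<integral>\<^sup>+x. ?b x \<partial>lborel) < top" by (simp add: less_top)
    from le_less_trans[OF fb this] have ffin: "(\<integral>\<^sup>+x. ?f x \<partial>lborel) < top" .
    have "(\<integral>\<^sup>+x. ?f x - ?b x \<partial>lborel) = (\<integral>\<^sup>+x. ?f x \<partial>lborel) - (\<integral>\<^sup>+x. ?b x \<partial>lborel)"
      by (rule nn_integral_diff) (use bfin le in auto)
    also have "\<dots> = 0" using fb ffin by (simp add: diff_eq_0_iff_ennreal)
    finally have "AE x in lborel. ?f x - ?b x = 0" by (subst (asm) nn_integral_0_iff_AE) auto
    then show ?thesis using fin
      by eventually_elim (auto simp: A_def diff_eq_0_iff_ennreal split: split_indicator_asm)
  qed
  then have AEb: "AE x in lborel. x \<in> S \<longrightarrow> f x \<le> ennreal (b x)"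
    by eventually_elim (auto simp: A_def)
  define \<rho> where "\<rho> x = (if x \<in> S then min (enn2real (f x)) (b x) else enn2real (f x))" for x
  have [measurable]: "\<rho> \<in> borel_measurable borel" unfolding \<rho>_def[abs_def] using f by measurable
  have "AE x in lborel. f x = ennreal (\<rho> x)"
    using AEb fin
  proof eventually_elim
    case (elim x)
    then have *: "ennreal (enn2real (f x)) = f x" by (simp add: ennreal_enn2real_if)
    show ?case
    proof (cases "x \<in> S")
      case True
      then have "enn2real (f x) \<le> b x" using elim(1) b0[OF True] by (simp add: enn2real_leI)
      then show ?thesis using True * by (simp add: \<rho>_def)
    qed (use * in \<open>simp add: \<rho>_def\<close>)
  qed
  then have "density lborel f = density lborel (\<lambda>x. ennreal (\<rho> x))"
    by (intro density_cong) auto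
  then have "distributed M lborel X (\<lambda>x. ennreal (\<rho> x))"
    unfolding distributed_def using dens by auto
  moreover have "0 \<le> \<rho> x" for x unfolding \<rho>_def using b0[of x] by simp
  moreover have "\<rho> x \<le> b x" if "x \<in> S" for x unfolding \<rho>_def using that by simp
  ultimately show ?thesis using that by blast
qed

section \<open>The law of the exponential functional\<close>

text \<open>The process is evaluated at the clamped time \<open>max 0 (min T s)\<close>, so that nothing is assumed outside
\<open>[0, T]\<close>. It is the limit of its values at the grid points \<open>\<lfloor>(k + 1) s\<rfloor> / (k + 1)\<close>.\<close>

lemma continuous_process_jointly_measurable:
  fixes Z :: "real \<Rightarrow> 'a \<Rightarrow> real"
  assumes T: "T \<ge> 0" and Z: "\<And>s. s \<in> {0..T} \<Longrightarrow> Z s \<in> borel_measurable P"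
    and cont: "\<And>\<omega>. \<omega> \<in> space P \<Longrightarrow> continuous_on {0..T} (\<lambda>s. Z s \<omega>)"
  shows "(\<lambda>(s, \<omega>). Z (max 0 (min T s)) \<omega>) \<in> borel_measurable (borel \<Otimes>\<^sub>M P)"
proof -
  define c where "c s = max 0 (min T s)" for s
  define g where "g k s = \<lfloor>(real k + 1) * c s\<rfloor>" for k :: nat and s
  have c: "c s \<in> {0..T}" for s unfolding c_def using T by auto
  have [measurable]: "c \<in> borel_measurable borel" unfolding c_def[abs_def] by measurable
  have approx: "(\<lambda>k. real_of_int (g k s) / (real k + 1)) \<longlonglongrightarrow> c s"
    and le: "real_of_int (g k s) / (real k + 1) \<in> {0..c s}" for s k
  proof -
    have b: "c s - inverse (real (Suc k)) \<le> real_of_int (g k s) / (real k + 1)" for k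
    proof -
      have "(real k + 1) * c s - 1 \<le> real_of_int (g k s)" unfolding g_def by linarith
      then have "((real k + 1) * c s - 1) / (real k + 1) \<le> real_of_int (g k s) / (real k + 1)"
        by (intro divide_right_mono) auto
      then show ?thesis by (simp add: diff_divide_distrib inverse_eq_divide add.commute)
    qed
    have u: "real_of_int (g k s) / (real k + 1) \<le> c s" for k
    proof -
      have "real_of_int (g k s) \<le> (real k + 1) * c s" unfolding g_def by linarith
      then show ?thesis by (simp add: field_simps)
    qed
    have "0 \<le> g k s" unfolding g_def using c[of s] by simp
    then show "real_of_int (g k s) / (real k + 1) \<in> {0..c s}" using u[of k] by simp
    have "(\<lambda>k. c s - inverse (real (Suc k))) \<longlonglongrightarrow> c s - 0"
      by (rule tendsto_diff[OF tendsto_const LIMSEQ_inverse_real_of_nat])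
    then have lim: "(\<lambda>k. c s - inverse (real (Suc k))) \<longlonglongrightarrow> c s" by (simp only: diff_0_right)
    show "(\<lambda>k. real_of_int (g k s) / (real k + 1)) \<longlonglongrightarrow> c s"
    proof (rule tendsto_sandwich[OF _ _ lim tendsto_const])
      show "\<forall>\<^sub>F k in sequentially. c s - inverse (real (Suc k)) \<le> real_of_int (g k s) / (real k + 1)"
        by (rule always_eventually) (rule allI, rule b)
      show "\<forall>\<^sub>F k in sequentially. real_of_int (g k s) / (real k + 1) \<le> c s"
        by (rule always_eventually) (rule allI, rule u)
    qed
  qed
  show ?thesis
  proof (rule borel_measurable_LIMSEQ_real)
    fix k :: nat
    show "(\<lambda>(s, \<omega>). Z (c (real_of_int (g k s) / (real k + 1))) \<omega>) \<in> borel_measurable (borel \<Otimes>\<^sub>M P)"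
    proof -
      have "(\<lambda>x. Z (c (real_of_int (g k (fst x)) / (real k + 1))) (snd x)) \<in> borel_measurable (borel \<Otimes>\<^sub>M P)"
      proof (rule measurable_compose_countable[where g = "\<lambda>x. g k (fst x)"
            and f = "\<lambda>i x. Z (c (real_of_int i / (real k + 1))) (snd x)"])
        fix i :: int
        show "(\<lambda>x. Z (c (real_of_int i / (real k + 1))) (snd x)) \<in> borel_measurable (borel \<Otimes>\<^sub>M P)"
          by (rule measurable_compose[OF measurable_snd Z[OF c]])
      next
        show "(\<lambda>x. g k (fst x)) \<in> borel \<Otimes>\<^sub>M P \<rightarrow>\<^sub>M count_space UNIV"
          unfolding g_def
          by (intro measurable_compose[OF _ measurable_real_floor] borel_measurable_times
              borel_measurable_const measurable_compose[OF measurable_fst \<open>c \<in> borel_measurable borel\<close>])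
      qed
      then show ?thesis by (simp add: split_beta)
    qed
  next
    fix x :: "real \<times> 'a" assume x: "x \<in> space (borel \<Otimes>\<^sub>M P)"
    obtain s \<omega> where xs: "x = (s, \<omega>)" by (cases x)
    then have \<omega>: "\<omega> \<in> space P" using x by (simp add: space_pair_measure)
    have cc: "c (real_of_int (g k s) / (real k + 1)) = real_of_int (g k s) / (real k + 1)" for k
    proof -
      have "real_of_int (g k s) / (real k + 1) \<in> {0..T}"
        using le[of k s] c[of s] unfolding atLeastAtMost_iff by linarith
      then show ?thesis by (simp add: c_def)
    qed
    have "(\<lambda>k. Z (real_of_int (g k s) / (real k + 1)) \<omega>) \<longlonglongrightarrow> Z (c s) \<omega>"
    proof (rule continuous_on_tendsto_compose[OF cont[OF \<omega>] approx c])
      show "\<forall>\<^sub>F k in sequentially. real_of_int (g k s) / (real k + 1) \<in> {0..T}"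
      proof (rule always_eventually, rule allI)
        fix k show "real_of_int (g k s) / (real k + 1) \<in> {0..T}"
          using le[of k s] c[of s] unfolding atLeastAtMost_iff by linarith
      qed
    qed
    then have "(\<lambda>k. Z (real_of_int (g k s) / (real k + 1)) \<omega>) \<longlonglongrightarrow> Z (max 0 (min T s)) \<omega>"
      by (simp only: c_def)
    then show "(\<lambda>k. case x of (s, \<omega>) \<Rightarrow> Z (c (real_of_int (g k s) / (real k + 1))) \<omega>)
        \<longlonglongrightarrow> (case x of (s, \<omega>) \<Rightarrow> Z (max 0 (min T s)) \<omega>)"
      unfolding xs by (simp only: prod.case cc)
  qed
qed

locale exp_functional = fbm M T H B for M :: "'w measure" and T H B +
  fixes a \<sigma> :: real
  assumes \<sigma>: "\<sigma> > 0"
begin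

definition e :: "real \<Rightarrow> 'w \<Rightarrow> real" where "e s \<omega> = exp (a * s + \<sigma> * B s \<omega>)"

definition F :: "'w \<Rightarrow> real" where "F \<omega> = (LINT s:{0..T}|lborel. e s \<omega>)"

definition bridge_exponent :: "'w \<Rightarrow> real \<Rightarrow> real" where "bridge_exponent \<omega> s = a * s + \<sigma> * W s \<omega>"

definition G :: "real \<Rightarrow> 'w \<Rightarrow> real" where "G n \<omega> = tilted_integral.\<Phi> T \<sigma> r (bridge_exponent \<omega>) n"

definition dG :: "real \<Rightarrow> 'w \<Rightarrow> real" where "dG n \<omega> = tilted_integral.D T \<sigma> r (bridge_exponent \<omega>) n"

lemma B_continuous: "\<omega> \<in> space M \<Longrightarrow> continuous_on {0..T} (\<lambda>s. B s \<omega>)"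
  using fbm unfolding fractional_brownian_motion_def by auto

lemma W_continuous: "\<omega> \<in> space M \<Longrightarrow> continuous_on {0..T} (\<lambda>s. W s \<omega>)"
  unfolding W_def by (intro continuous_intros B_continuous continuous_on_r)

lemma e_continuous: "\<omega> \<in> space M \<Longrightarrow> continuous_on {0..T} (\<lambda>s. e s \<omega>)"
  unfolding e_def by (intro continuous_intros B_continuous)

lemma e_pos: "e s \<omega> > 0" unfolding e_def by simp

lemma tilted:
  assumes "\<omega> \<in> space M"
  shows "tilted_integral T \<sigma> r (bridge_exponent \<omega>)"
  by unfold_locales
    (use assms T \<sigma> r_nonneg r_le_1 r_T in \<open>auto simp: bridge_exponent_def[abs_def] intro!: continuous_intros W_continuous continuous_on_r\<close>)

lemma G_eq: "\<omega> \<in> space M \<Longrightarrow> G n \<omega> = (LINT s:{0..T}|lborel. exp (a * s + \<sigma> * W s \<omega> + \<sigma> * r s * n))"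
  unfolding G_def tilted_integral.\<Phi>_def[OF tilted] by (simp add: bridge_exponent_def)

lemma dG_eq: "\<omega> \<in> space M \<Longrightarrow> dG n \<omega> = (LINT s:{0..T}|lborel. \<sigma> * r s * exp (a * s + \<sigma> * W s \<omega> + \<sigma> * r s * n))"
  unfolding dG_def tilted_integral.D_def[OF tilted] by (simp add: bridge_exponent_def)

lemma dG_pos: "\<omega> \<in> space M \<Longrightarrow> dG n \<omega> > 0"
  unfolding dG_def by (rule tilted_integral.D_pos[OF tilted])

lemma exponent_split: "a * s + \<sigma> * W s \<omega> + \<sigma> * r s * B T \<omega> = a * s + \<sigma> * B s \<omega>"
  unfolding W_def by (simp add: algebra_simps)

lemma F_eq_G: "\<omega> \<in> space M \<Longrightarrow> F \<omega> = G (B T \<omega>) \<omega>"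
  unfolding G_eq exponent_split F_def e_def ..

lemma F_pos: "\<omega> \<in> space M \<Longrightarrow> F \<omega> > 0"
  unfolding F_eq_G G_def by (rule tilted_integral.Phi_pos[OF tilted])

lemma dG_endpoint: "\<omega> \<in> space M \<Longrightarrow> dG (B T \<omega>) \<omega> = \<sigma> * (LINT s:{0..T}|lborel. r s * e s \<omega>)"
  unfolding dG_eq exponent_split e_def by (simp add: mult.assoc)

definition clamp_time :: "real \<Rightarrow> real" where "clamp_time s = max 0 (min T s)"

lemma clamp_time_in: "clamp_time s \<in> {0..T}" unfolding clamp_time_def using T by auto

lemma clamp_time_id: "s \<in> {0..T} \<Longrightarrow> clamp_time s = s" unfolding clamp_time_def by auto

lemma clamp_time_measurable [measurable]: "clamp_time \<in> borel_measurable borel"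
  unfolding clamp_time_def[abs_def] by measurable

lemma r_clamp_measurable [measurable]: "(\<lambda>s. r (clamp_time s)) \<in> borel_measurable borel"
  by (intro borel_measurable_continuous_onI continuous_on_compose2[OF continuous_on_r])
    (use T in \<open>auto simp: clamp_time_def[abs_def] intro!: continuous_intros\<close>)

lemma W_jointly_measurable [measurable]:
  "(\<lambda>x. W (clamp_time (fst x)) (snd x)) \<in> borel_measurable (borel \<Otimes>\<^sub>M bridge_space)"
  using continuous_process_jointly_measurable[of T W bridge_space] T path_space_measurable[of _ "{0..T}" W]
    W_continuous by (simp add: clamp_time_def split_beta less_imp_le)

lemma B_jointly_measurable [measurable]:
  "(\<lambda>x. B (clamp_time (fst x)) (snd x)) \<in> borel_measurable (borel \<Otimes>\<^sub>M M)"
  using continuous_process_jointly_measurable[of T B M] T B_measurable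
    B_continuous by (simp add: clamp_time_def split_beta less_imp_le)

lemma bridge_integral_measurable:
  fixes q :: "real \<Rightarrow> real"
  assumes [measurable]: "(\<lambda>s. q (clamp_time s)) \<in> borel_measurable borel"
  shows "(\<lambda>x. LINT s:{0..T}|lborel. q s * exp (a * s + \<sigma> * W s (snd x) + \<sigma> * r s * fst x))
    \<in> borel_measurable (borel \<Otimes>\<^sub>M bridge_space)"
proof -
  have [measurable]: "(\<lambda>z. W (clamp_time (snd z)) (snd (fst z))) \<in> borel_measurable ((borel \<Otimes>\<^sub>M bridge_space) \<Otimes>\<^sub>M lborel)"
  proof -
    have "(\<lambda>z. (snd z, snd (fst z))) \<in> ((borel \<Otimes>\<^sub>M bridge_space) \<Otimes>\<^sub>M lborel) \<rightarrow>\<^sub>M borel \<Otimes>\<^sub>M bridge_space"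
      by measurable
    from measurable_compose[OF this W_jointly_measurable] show ?thesis by simp
  qed
  have eq: "(LINT s:{0..T}|lborel. q s * exp (a * s + \<sigma> * W s (snd x) + \<sigma> * r s * fst x)) =
    (LINT s|lborel. indicator {0..T} s * (q (clamp_time s) * exp (a * clamp_time s + \<sigma> * W (clamp_time s) (snd x) + \<sigma> * r (clamp_time s) * fst x)))" for x
    unfolding set_lebesgue_integral_def
    by (rule Bochner_Integration.integral_cong) (auto simp: clamp_time_id split: split_indicator)
  show ?thesis unfolding eq
    by (rule lborel.borel_measurable_lebesgue_integral) (simp add: split_beta)
qed

lemma G_measurable [measurable]: "(\<lambda>x. G (fst x) (snd x)) \<in> borel_measurable (borel \<Otimes>\<^sub>M bridge_space)"
proof -
  have "(\<lambda>x. LINT s:{0..T}|lborel. 1 * exp (a * s + \<sigma> * W s (snd x) + \<sigma> * r s * fst x))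
    \<in> borel_measurable (borel \<Otimes>\<^sub>M bridge_space)"
    by (rule bridge_integral_measurable) simp
  then show ?thesis
    by (rule measurable_cong[THEN iffD1, rotated]) (auto simp: G_eq space_pair_measure)
qed

lemma dG_measurable [measurable]: "(\<lambda>x. dG (fst x) (snd x)) \<in> borel_measurable (borel \<Otimes>\<^sub>M bridge_space)"
proof -
  have "(\<lambda>x. LINT s:{0..T}|lborel. (\<sigma> * r s) * exp (a * s + \<sigma> * W s (snd x) + \<sigma> * r s * fst x))
    \<in> borel_measurable (borel \<Otimes>\<^sub>M bridge_space)"
    by (rule bridge_integral_measurable) simp
  then show ?thesis
    by (rule measurable_cong[THEN iffD1, rotated]) (auto simp: dG_eq space_pair_measure)
qed

lemma endpoint_pair_measurable: "(\<lambda>\<omega>. (B T \<omega>, \<omega>)) \<in> M \<rightarrow>\<^sub>M borel \<Otimes>\<^sub>M bridge_space"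
  by (rule measurable_Pair[OF B_measurable[OF T_in] id_measurable_bridge_space])

lemma F_measurable [measurable]: "F \<in> borel_measurable M"
  using measurable_compose[OF endpoint_pair_measurable G_measurable]
  by (rule measurable_cong[THEN iffD1, rotated]) (simp add: F_eq_G)

definition weight :: "real \<Rightarrow> 'w \<Rightarrow> real" where
  "weight n \<omega> = exp (\<sigma> + 1 / (2 * \<tau>) + \<bar>n\<bar> / \<tau>) / dG n \<omega>"

lemma weight_measurable [measurable]: "(\<lambda>x. weight (fst x) (snd x)) \<in> borel_measurable (borel \<Otimes>\<^sub>M bridge_space)"
  unfolding weight_def by measurable

lemma endpoint_weight_measurable [measurable]: "(\<lambda>\<omega>. weight (B T \<omega>) \<omega>) \<in> borel_measurable M"
  using measurable_compose[OF endpoint_pair_measurable weight_measurable] by simp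

text \<open>The function that will dominate the density of \<open>F\<close>.\<close>

definition \<kappa> :: "real \<Rightarrow> ennreal" where
  "\<kappa> x = (\<integral>\<^sup>+\<omega>. ennreal (weight (B T \<omega>) \<omega>) * indicator {x..} (F \<omega>) \<partial>M)"

text \<open>For a fixed bridge path this is \<open>window_bound\<close>. Independence of the endpoint and the bridge allows the endpoint to be
integrated first and the outcome to be read again as an expectation over the original process.\<close>

lemma law_dominated:
  fixes \<psi> :: "real \<Rightarrow> ennreal"
  assumes \<psi>[measurable]: "\<psi> \<in> borel_measurable borel"
  shows "(\<integral>\<^sup>+\<omega>. \<psi> (F \<omega>) \<partial>M) \<le> (\<integral>\<^sup>+x. \<psi> x * \<kappa> x \<partial>lborel)"
proof -
  let ?\<phi> = "normal_density 0 (sqrt \<tau>)"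
  define h where "h y = ennreal (weight (fst y) (snd y)) * (\<integral>\<^sup>+x. \<psi> x * indicator {..G (fst y) (snd y)} x \<partial>lborel)" for y
  have hm: "h \<in> borel_measurable (borel \<Otimes>\<^sub>M bridge_space)"
  proof -
    have [measurable]: "(\<lambda>z. G (fst (fst z)) (snd (fst z))) \<in> borel_measurable ((borel \<Otimes>\<^sub>M bridge_space) \<Otimes>\<^sub>M lborel)"
      using measurable_compose[OF measurable_fst G_measurable] by simp
    have "(\<lambda>z. \<psi> (snd z) * (if snd z \<le> G (fst (fst z)) (snd (fst z)) then 1 else 0))
        \<in> borel_measurable ((borel \<Otimes>\<^sub>M bridge_space) \<Otimes>\<^sub>M lborel)"
      by measurable
    then have "(\<lambda>(y, x). \<psi> x * indicator {..G (fst y) (snd y)} x)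
        \<in> borel_measurable ((borel \<Otimes>\<^sub>M bridge_space) \<Otimes>\<^sub>M lborel)"
      by (simp add: split_beta indicator_def of_bool_def)
    then have "(\<lambda>y. \<integral>\<^sup>+x. \<psi> x * indicator {..G (fst y) (snd y)} x \<partial>lborel) \<in> borel_measurable (borel \<Otimes>\<^sub>M bridge_space)"
      by (rule lborel.borel_measurable_nn_integral)
    then show ?thesis unfolding h_def[abs_def] by measurable
  qed
  have \<psi>G: "(\<lambda>y. \<psi> (G (fst y) (snd y))) \<in> borel_measurable (borel \<Otimes>\<^sub>M bridge_space)"
    by (rule measurable_compose[OF G_measurable \<psi>])
  have "(\<integral>\<^sup>+\<omega>. \<psi> (F \<omega>) \<partial>M) = (\<integral>\<^sup>+\<omega>. \<psi> (G (fst (B T \<omega>, \<omega>)) (snd (B T \<omega>, \<omega>))) \<partial>M)"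
    by (rule nn_integral_cong) (simp add: F_eq_G)
  also have "\<dots> = (\<integral>\<^sup>+\<omega>. (\<integral>\<^sup>+n. ennreal (?\<phi> n) * \<psi> (G n \<omega>) \<partial>lborel) \<partial>M)"
    unfolding disintegrate_endpoint[OF \<psi>G] by simp
  also have "\<dots> \<le> (\<integral>\<^sup>+\<omega>. (\<integral>\<^sup>+n. ennreal (?\<phi> n) * h (n, \<omega>) \<partial>lborel) \<partial>M)"
    by (rule nn_integral_mono)
      (use tilted_integral.window_bound[OF tilted \<psi> tau_pos] in \<open>simp add: h_def G_def dG_def weight_def\<close>)
  also have "\<dots> = (\<integral>\<^sup>+\<omega>. h (B T \<omega>, \<omega>) \<partial>M)"
    by (rule disintegrate_endpoint[OF hm, symmetric])
  also have "\<dots> = (\<integral>\<^sup>+\<omega>. (\<integral>\<^sup>+x. \<psi> x * (ennreal (weight (B T \<omega>) \<omega>) * indicator {x..} (F \<omega>)) \<partial>lborel) \<partial>M)"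
  proof (rule nn_integral_cong)
    fix \<omega> assume \<omega>: "\<omega> \<in> space M"
    have "h (B T \<omega>, \<omega>) = (\<integral>\<^sup>+x. ennreal (weight (B T \<omega>) \<omega>) * (\<psi> x * indicator {..F \<omega>} x) \<partial>lborel)"
      unfolding h_def by (subst nn_integral_cmult) (auto simp: F_eq_G[OF \<omega>])
    also have "\<dots> = (\<integral>\<^sup>+x. \<psi> x * (ennreal (weight (B T \<omega>) \<omega>) * indicator {x..} (F \<omega>)) \<partial>lborel)"
      by (rule nn_integral_cong) (simp add: indicator_def mult_ac)
    finally show "h (B T \<omega>, \<omega>) = \<dots>" .
  qed
  also have "\<dots> = (\<integral>\<^sup>+x. (\<integral>\<^sup>+\<omega>. \<psi> x * (ennreal (weight (B T \<omega>) \<omega>) * indicator {x..} (F \<omega>)) \<partial>M) \<partial>lborel)"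
  proof -
    interpret LM: pair_sigma_finite lborel M ..
    have "(\<lambda>z. \<psi> (fst z) * (ennreal (weight (B T (snd z)) (snd z)) * (if fst z \<le> F (snd z) then 1 else 0)))
      \<in> borel_measurable (lborel \<Otimes>\<^sub>M M)"
      by measurable
    then show ?thesis
      by (intro LM.Fubini') (simp add: split_beta indicator_def of_bool_def)
  qed
  also have "\<dots> = (\<integral>\<^sup>+x. \<psi> x * \<kappa> x \<partial>lborel)"
  proof (rule nn_integral_cong)
    fix x :: real
    have "(\<lambda>\<omega>. ennreal (weight (B T \<omega>) \<omega>) * (if x \<le> F \<omega> then 1 else 0)) \<in> borel_measurable M"
      by measurable
    then have "(\<lambda>\<omega>. ennreal (weight (B T \<omega>) \<omega>) * indicator {x..} (F \<omega>)) \<in> borel_measurable M"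
      by (simp add: indicator_def of_bool_def)
    then show "(\<integral>\<^sup>+\<omega>. \<psi> x * (ennreal (weight (B T \<omega>) \<omega>) * indicator {x..} (F \<omega>)) \<partial>M) = \<psi> x * \<kappa> x"
      unfolding \<kappa>_def by (rule nn_integral_cmult)
  qed
  finally show ?thesis .
qed

section \<open>Estimate of the dominating function\<close>

definition r_mass :: real where "r_mass = (LINT s:{0..T}|lborel. r s)"

lemma r_mass_pos: "r_mass > 0"
  unfolding r_mass_def
  by (rule set_lebesgue_integral_pos_Icc) (use T r_nonneg r_T continuous_on_r in auto)

lemma inverse_dG_le:
  assumes \<omega>: "\<omega> \<in> space M"
  shows "1 / dG (B T \<omega>) \<omega> \<le> 1 / (\<sigma> * r_mass\<^sup>2) * (LINT t:{0..T}|lborel. 1 / e t \<omega>)"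
proof -
  have c: "continuous_on {0..T} (\<lambda>t. r t / e t \<omega>)" "continuous_on {0..T} (\<lambda>t. 1 / e t \<omega>)"
    using e_pos by (auto intro!: continuous_intros e_continuous[OF \<omega>] continuous_on_r simp: less_imp_neq[symmetric])
  have "1 / (LINT s:{0..T}|lborel. r s * e s \<omega>) \<le> (LINT t:{0..T}|lborel. r t / e t \<omega>) / r_mass\<^sup>2"
    unfolding r_mass_def
    by (rule inverse_integral_le) (use T r_nonneg r_T continuous_on_r e_pos e_continuous[OF \<omega>] in auto)
  also have "\<dots> \<le> (LINT t:{0..T}|lborel. 1 / e t \<omega>) / r_mass\<^sup>2"
    by (intro divide_right_mono set_integral_mono borel_integrable_atLeastAtMost' c)
      (use r_le_1 e_pos in \<open>auto intro!: divide_right_mono simp: less_imp_le\<close>)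
  finally have "1 / \<sigma> * (1 / (LINT s:{0..T}|lborel. r s * e s \<omega>)) \<le>
      1 / \<sigma> * ((LINT t:{0..T}|lborel. 1 / e t \<omega>) / r_mass\<^sup>2)"
    using \<sigma> by (intro mult_left_mono) auto
  then show ?thesis unfolding dG_endpoint[OF \<omega>] by simp
qed

definition \<beta> :: real where "\<beta> = \<sigma>\<^sup>2 * \<tau> / (2 * T)"

lemma beta_pos: "\<beta> > 0" unfolding \<beta>_def using \<sigma> tau_pos T by simp

definition weight_const :: real where "weight_const = exp (\<sigma> + 1 / (2 * \<tau>)) / (\<sigma> * r_mass\<^sup>2)"

definition mgf_const :: real where "mgf_const = (\<sigma>\<^sup>2 * \<tau> + 2 * \<sigma> + 1 / \<tau>) / 2"

lemma weight_const_pos: "weight_const > 0" unfolding weight_const_def using \<sigma> r_mass_pos by simp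

lemma weight_le:
  assumes \<omega>: "\<omega> \<in> space M"
  shows "weight (B T \<omega>) \<omega> \<le>
    weight_const * (exp (B T \<omega> / \<tau>) + exp (- B T \<omega> / \<tau>)) * (LINT t:{0..T}|lborel. 1 / e t \<omega>)"
proof -
  let ?I = "LINT t:{0..T}|lborel. 1 / e t \<omega>"
  have "exp (\<bar>B T \<omega>\<bar> / \<tau>) \<le> exp (B T \<omega> / \<tau>) + exp (- B T \<omega> / \<tau>)"
    by (cases "B T \<omega> \<ge> 0") (auto simp: abs_if)
  moreover have "1 / dG (B T \<omega>) \<omega> \<ge> 0" using dG_pos[OF \<omega>, of "B T \<omega>"] by simp
  ultimately have "(exp (\<sigma> + 1 / (2 * \<tau>)) * exp (\<bar>B T \<omega>\<bar> / \<tau>)) * (1 / dG (B T \<omega>) \<omega>) \<le>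
      (exp (\<sigma> + 1 / (2 * \<tau>)) * (exp (B T \<omega> / \<tau>) + exp (- B T \<omega> / \<tau>))) * (1 / (\<sigma> * r_mass\<^sup>2) * ?I)"
    using inverse_dG_le[OF \<omega>] by (intro mult_mono) (auto simp: add_nonneg_nonneg)
  then show ?thesis unfolding weight_def weight_const_def exp_add by simp
qed

text \<open>The indicator of \<open>F \<ge> x\<close> and the weight are replaced by integrals over \<open>s\<close> and \<open>t\<close>, whose integrands have
explicit Gaussian expectations. The rate \<open>\<beta>\<close> is chosen such that the growth
\<open>exp (\<beta> p\<^sup>2 (T - s))\<close> caused by the weight and the bound \<open>exp (\<beta> p\<^sup>2 s)\<close> for the quadratic part of the
moment multiply to the constant \<open>exp (p\<^sup>2 \<sigma>\<^sup>2 \<tau> / 2)\<close>.\<close>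

lemma kappa_bound:
  assumes x: "x > 0" and p: "p \<ge> 1"
  shows "\<kappa> x \<le> ennreal (2 * T\<^sup>2 * weight_const * exp (\<bar>a\<bar> * T + mgf_const) * (\<beta> * p) *
    exp (real p * (\<bar>a\<bar> * T + \<sigma>) + (real p)\<^sup>2 * (\<sigma>\<^sup>2 * \<tau>) / 2) / (x * (\<beta> * p)) ^ p)"
proof -
  define k where "k = \<beta> * real p"
  have k: "k > 0" unfolding k_def using beta_pos p by simp
  define w where "w s = k * exp (- k * (T - s))" for s
  have w: "w s > 0" for s unfolding w_def using k by simp
  have wc: "continuous_on {0..T} w" unfolding w_def[abs_def] by (intro continuous_intros)
  have w1: "(LINT s:{0..T}|lborel. w s) \<le> 1"
    unfolding w_def by (rule exponential_weight_integral_le_1[OF T k])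
  have [measurable]: "w \<in> borel_measurable borel" unfolding w_def[abs_def] by measurable
  have em [measurable]: "(\<lambda>z. e (clamp_time (fst z)) (snd z)) \<in> borel_measurable (borel \<Otimes>\<^sub>M M)"
    unfolding e_def by measurable
  have em' [measurable]: "e (clamp_time s) \<in> borel_measurable M" for s
    using measurable_compose[OF measurable_Pair1' em, of s] by (simp add: space_pair_measure)
  note [measurable] = B_measurable[OF T_in]
  \<comment> \<open>Times are clamped to make these functions measurable on the whole line.\<close>
  define E where "E \<omega> = ennreal (weight_const * (exp (B T \<omega> / \<tau>) + exp (- B T \<omega> / \<tau>)))" for \<omega>
  define P where "P t \<omega> = ennreal (1 / e (clamp_time t) \<omega>) * indicator {0..T} t" for t \<omega>
  define Q where "Q s \<omega> = ennreal ((e (clamp_time s) \<omega> / (x * w s)) ^ p * w s) * indicator {0..T} s" for s \<omega>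
  have Em [measurable]: "E \<in> borel_measurable M" unfolding E_def[abs_def] by measurable
  have Pm [measurable]: "(\<lambda>z. P (fst z) (snd z)) \<in> borel_measurable (borel \<Otimes>\<^sub>M M)"
    unfolding P_def by measurable
  have Qm [measurable]: "(\<lambda>z. Q (fst z) (snd z)) \<in> borel_measurable (borel \<Otimes>\<^sub>M M)"
    unfolding Q_def by measurable
  have Pm' [measurable]: "P t \<in> borel_measurable M" for t unfolding P_def[abs_def] by measurable
  have Qm' [measurable]: "Q t \<in> borel_measurable M" for t unfolding Q_def[abs_def] by measurable
  have "\<kappa> x \<le> (\<integral>\<^sup>+\<omega>. (\<integral>\<^sup>+t. (\<integral>\<^sup>+s. E \<omega> * P t \<omega> * Q s \<omega> \<partial>lborel) \<partial>lborel) \<partial>M)"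
    unfolding \<kappa>_def
  proof (rule nn_integral_mono)
    fix \<omega> assume \<omega>: "\<omega> \<in> space M"
    have [measurable]: "(\<lambda>t. P t \<omega>) \<in> borel_measurable borel" "(\<lambda>s. Q s \<omega>) \<in> borel_measurable borel"
      using measurable_compose[OF measurable_Pair2'[OF \<omega>] Pm] measurable_compose[OF measurable_Pair2'[OF \<omega>] Qm] by simp_all
    let ?I = "LINT t:{0..T}|lborel. 1 / e t \<omega>"
    let ?J = "LINT s:{0..T}|lborel. (e s \<omega> / (x * w s)) ^ p * w s"
    have IP: "ennreal ?I = (\<integral>\<^sup>+t. P t \<omega> \<partial>lborel)"
      unfolding P_def using e_pos e_continuous[OF \<omega>]
      by (subst ennreal_set_integral_Icc)
        (auto intro!: nn_integral_cong continuous_intros simp: clamp_time_id less_imp_le less_imp_neq[symmetric] split: split_indicator)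
    have JQ: "ennreal ?J = (\<integral>\<^sup>+s. Q s \<omega> \<partial>lborel)"
      unfolding Q_def using e_pos e_continuous[OF \<omega>] w wc x
      by (subst ennreal_set_integral_Icc)
        (auto intro!: nn_integral_cong continuous_intros simp: clamp_time_id less_imp_le less_imp_neq[symmetric] split: split_indicator)
    have "ennreal (weight (B T \<omega>) \<omega>) * indicator {x..} (F \<omega>) \<le> (E \<omega> * ennreal ?I) * ennreal ?J"
    proof (rule mult_mono)
      have "0 \<le> ?I" unfolding set_lebesgue_integral_def
        by (rule Bochner_Integration.integral_nonneg) (use e_pos in \<open>auto simp: less_imp_le split: split_indicator\<close>)
      moreover have "0 \<le> weight_const * (exp (B T \<omega> / \<tau>) + exp (- B T \<omega> / \<tau>))"
        using weight_const_pos by (simp add: add_nonneg_nonneg)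
      ultimately show "ennreal (weight (B T \<omega>) \<omega>) \<le> E \<omega> * ennreal ?I"
        unfolding E_def using ennreal_leI[OF weight_le[OF \<omega>]] by (simp add: ennreal_mult)
      show "indicator {x..} (F \<omega>) \<le> ennreal ?J"
      proof (cases "x \<le> F \<omega>")
        case True
        have "1 \<le> ?J"
          by (rule one_le_weighted_power_integral[OF e_continuous[OF \<omega>] _ wc _ w1 x _ p])
            (use True e_pos w in \<open>auto simp: F_def\<close>)
        then have "ennreal 1 \<le> ennreal ?J" by (rule ennreal_leI)
        then show ?thesis using True by simp
      qed simp
    qed simp_all
    also have "\<dots> = (\<integral>\<^sup>+t. (\<integral>\<^sup>+s. E \<omega> * P t \<omega> * Q s \<omega> \<partial>lborel) \<partial>lborel)"
      unfolding IP JQ by (simp add: nn_integral_cmult nn_integral_multc)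
    finally show "ennreal (weight (B T \<omega>) \<omega>) * indicator {x..} (F \<omega>) \<le> \<dots>" .
  qed
  also have "\<dots> = (\<integral>\<^sup>+t. (\<integral>\<^sup>+s. (\<integral>\<^sup>+\<omega>. E \<omega> * P t \<omega> * Q s \<omega> \<partial>M) \<partial>lborel) \<partial>lborel)"
  proof -
    interpret LM: pair_sigma_finite lborel M ..
    have Pm2 [measurable]: "(\<lambda>z. P (fst z) (snd z)) \<in> borel_measurable (lborel \<Otimes>\<^sub>M M)"
      and Qm2 [measurable]: "(\<lambda>z. Q (fst z) (snd z)) \<in> borel_measurable (lborel \<Otimes>\<^sub>M M)"
      using Pm Qm by (simp_all cong: measurable_cong_sets sets_pair_measure_cong)
    have m2: "(\<lambda>(s, \<omega>). E \<omega> * P t \<omega> * Q s \<omega>) \<in> borel_measurable (lborel \<Otimes>\<^sub>M M)" for t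
      unfolding split_beta by measurable
    have m3: "(\<lambda>(t, \<omega>). \<integral>\<^sup>+s. E \<omega> * P t \<omega> * Q s \<omega> \<partial>lborel) \<in> borel_measurable (lborel \<Otimes>\<^sub>M M)"
    proof -
      have "(\<lambda>z. Q (snd z) (snd (fst z))) \<in> borel_measurable ((lborel \<Otimes>\<^sub>M M) \<Otimes>\<^sub>M lborel)"
      proof -
        have "(\<lambda>z. (snd z, snd (fst z))) \<in> ((lborel \<Otimes>\<^sub>M M) \<Otimes>\<^sub>M lborel) \<rightarrow>\<^sub>M lborel \<Otimes>\<^sub>M M" by measurable
        from measurable_compose[OF this Qm2] show ?thesis by simp
      qed
      moreover have "(\<lambda>z. P (fst (fst z)) (snd (fst z))) \<in> borel_measurable ((lborel \<Otimes>\<^sub>M M) \<Otimes>\<^sub>M lborel)"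
        using measurable_compose[OF measurable_fst Pm2] by simp
      ultimately have "(\<lambda>z. E (snd (fst z)) * P (fst (fst z)) (snd (fst z)) * Q (snd z) (snd (fst z)))
          \<in> borel_measurable ((lborel \<Otimes>\<^sub>M M) \<Otimes>\<^sub>M lborel)"
        by measurable
      then have "(\<lambda>y. \<integral>\<^sup>+s. E (snd y) * P (fst y) (snd y) * Q s (snd y) \<partial>lborel) \<in> borel_measurable (lborel \<Otimes>\<^sub>M M)"
        by (intro lborel.borel_measurable_nn_integral) (simp add: split_beta)
      then show ?thesis by (simp add: split_beta)
    qed
    show ?thesis
      unfolding LM.Fubini'[OF m3] LM.Fubini'[OF m2] ..
  qed
  also have "\<dots> \<le> (\<integral>\<^sup>+t. (\<integral>\<^sup>+s. ennreal (2 * weight_const * exp (\<bar>a\<bar> * T + mgf_const) * k *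
      exp (real p * (\<bar>a\<bar> * T + \<sigma>) + (real p)\<^sup>2 * (\<sigma>\<^sup>2 * \<tau>) / 2) / (x * k) ^ p) * indicator {0..T} t * indicator {0..T} s \<partial>lborel) \<partial>lborel)"
  proof (intro nn_integral_mono)
    fix s t :: real
    let ?C = "2 * weight_const * exp (\<bar>a\<bar> * T + mgf_const) * k * exp (real p * (\<bar>a\<bar> * T + \<sigma>) + (real p)\<^sup>2 * (\<sigma>\<^sup>2 * \<tau>) / 2) / (x * k) ^ p"
    show "(\<integral>\<^sup>+\<omega>. E \<omega> * P t \<omega> * Q s \<omega> \<partial>M) \<le> ennreal ?C * indicator {0..T} t * indicator {0..T} s"
    proof (cases "s \<in> {0..T} \<and> t \<in> {0..T}")
      case False
      then have zero: "E \<omega> * P t \<omega> * Q s \<omega> = 0" for \<omega> unfolding P_def Q_def by auto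
      show ?thesis unfolding zero by simp
    next
      case True
      then have s: "s \<in> {0..T}" and t: "t \<in> {0..T}" by auto
      define c where "c = (1 / (x * w s)) ^ p * w s"
      have c0: "c > 0" unfolding c_def using w[of s] x by simp
      define K where "K = weight_const * c * exp (real p * a * s - a * t)"
      have K0: "K \<ge> 0" unfolding K_def using weight_const_pos c0 by simp
      define m where "m = (real p)\<^sup>2 * \<sigma>\<^sup>2 * s powr (2 * H) / 2 + real p * \<sigma> + mgf_const"
      let ?X = "\<lambda>\<epsilon> \<omega>. exp (real p * \<sigma> * B s \<omega> - \<sigma> * B t \<omega> + \<epsilon> / \<tau> * B T \<omega>)"
      note [measurable] = B_measurable[OF s] B_measurable[OF t]
      have pt: "E \<omega> * P t \<omega> * Q s \<omega> = ennreal K * (ennreal (?X 1 \<omega>) + ennreal (?X (-1) \<omega>))" for \<omega>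
      proof -
        have "E \<omega> * P t \<omega> * Q s \<omega> = ennreal (weight_const * (exp (B T \<omega> / \<tau>) + exp (- B T \<omega> / \<tau>)) * (1 / e t \<omega>) * ((e s \<omega> / (x * w s)) ^ p * w s))"
          unfolding E_def P_def Q_def using s t weight_const_pos e_pos[of t \<omega>] e_pos[of s \<omega>] w[of s] x
          by (simp add: clamp_time_id ennreal_mult[symmetric] less_imp_le add_nonneg_nonneg)
        also have "(e s \<omega> / (x * w s)) ^ p * w s = e s \<omega> ^ p * c" unfolding c_def by (simp add: power_divide)
        also have "e s \<omega> ^ p = exp (real p * (a * s + \<sigma> * B s \<omega>))" unfolding e_def by (simp add: exp_of_nat_mult)
        also have "1 / e t \<omega> = exp (- (a * t + \<sigma> * B t \<omega>))" unfolding e_def exp_minus by (simp add: inverse_eq_divide)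
        also have "weight_const * (exp (B T \<omega> / \<tau>) + exp (- B T \<omega> / \<tau>)) * exp (- (a * t + \<sigma> * B t \<omega>)) *
            (exp (real p * (a * s + \<sigma> * B s \<omega>)) * c) = K * (?X 1 \<omega> + ?X (-1) \<omega>)"
          unfolding K_def by (simp add: algebra_simps flip: exp_add)
        finally show ?thesis using K0 by (simp add: ennreal_mult ennreal_plus)
      qed
      have "(\<integral>\<^sup>+\<omega>. E \<omega> * P t \<omega> * Q s \<omega> \<partial>M) = ennreal K * ((\<integral>\<^sup>+\<omega>. ennreal (?X 1 \<omega>) \<partial>M) + (\<integral>\<^sup>+\<omega>. ennreal (?X (-1) \<omega>) \<partial>M))"
        unfolding pt by (simp add: nn_integral_cmult nn_integral_add)
      also have "\<dots> \<le> ennreal K * (ennreal (exp m) + ennreal (exp m))"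
        using mgf_bound[OF s t \<sigma>, of 1 p] mgf_bound[OF s t \<sigma>, of "-1" p]
        by (intro mult_left_mono add_mono) (auto simp: m_def mgf_const_def)
      also have "\<dots> = ennreal (2 * K * exp m)"
        using K0 by (simp add: ennreal_plus[symmetric] ennreal_mult[symmetric] del: ennreal_plus)
      also have "\<dots> \<le> ennreal ?C"
      proof (rule ennreal_leI)
        \<comment> \<open>Since \<open>c = x\<^sup>-\<^sup>p w\<^sup>1\<^sup>-\<^sup>p\<close>, its exponent is \<open>(p - 1) k (T - s)\<close>; enlarged to \<open>p k (T - s)\<close>, it cancels the variance term exactly.\<close>
        have cb: "c \<le> k / (x * k) ^ p * exp (real p * (k * (T - s)))"
        proof -
          let ?E = "exp (- k * (T - s))"
          have "c = (k / (x * k) ^ p) * ((1 / ?E) ^ p * ?E)"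
            unfolding c_def w_def using k x by (simp add: power_divide power_mult_distrib)
          also have "\<dots> \<le> (k / (x * k) ^ p) * ((1 / ?E) ^ p * 1)"
            using k x s by (intro mult_left_mono) auto
          also have "1 / ?E = exp (k * (T - s))" by (simp add: exp_minus inverse_eq_divide)
          also have "exp (k * (T - s)) ^ p = exp (real p * (k * (T - s)))"
            by (rule exp_of_nat_mult[symmetric])
          finally show ?thesis by simp
        qed
        have sub: "s powr (2 * H) \<le> \<tau> * s / T" by (rule powr_le_linear[OF s])
        have "(real p)\<^sup>2 * \<sigma>\<^sup>2 * s powr (2 * H) / 2 \<le> (real p)\<^sup>2 * \<sigma>\<^sup>2 * (\<tau> * s / T) / 2"
          by (intro divide_right_mono mult_left_mono sub) auto
        moreover have "real p * (k * (T - s)) + (real p)\<^sup>2 * \<sigma>\<^sup>2 * (\<tau> * s / T) / 2 = (real p)\<^sup>2 * (\<sigma>\<^sup>2 * \<tau>) / 2"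
          unfolding k_def \<beta>_def using T by (simp add: field_simps power2_eq_square)
        moreover have "real p * a * s - a * t \<le> real p * (\<bar>a\<bar> * T) + \<bar>a\<bar> * T"
        proof -
          have "a * s \<le> \<bar>a\<bar> * T" using s T by (metis abs_ge_self abs_ge_zero atLeastAtMost_iff mult_mono)
          then have "real p * (a * s) \<le> real p * (\<bar>a\<bar> * T)" by (rule mult_left_mono) simp
          moreover have "- a * t \<le> \<bar>a\<bar> * T" using t T
            by (metis abs_ge_minus_self abs_ge_zero atLeastAtMost_iff mult_mono)
          ultimately show ?thesis by simp
        qed
        ultimately have ex: "real p * (k * (T - s)) + (real p * a * s - a * t) + m \<le>
            (\<bar>a\<bar> * T + mgf_const) + (real p * (\<bar>a\<bar> * T + \<sigma>) + (real p)\<^sup>2 * (\<sigma>\<^sup>2 * \<tau>) / 2)"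
          unfolding m_def by (simp add: algebra_simps)
        have "2 * K * exp m = 2 * weight_const * c * exp ((real p * a * s - a * t) + m)"
          unfolding K_def exp_add by simp
        also have "\<dots> \<le> 2 * weight_const * (k / (x * k) ^ p * exp (real p * (k * (T - s)))) * exp ((real p * a * s - a * t) + m)"
          using weight_const_pos by (intro mult_right_mono mult_left_mono cb) auto
        also have "\<dots> = 2 * weight_const * (k / (x * k) ^ p) * exp (real p * (k * (T - s)) + (real p * a * s - a * t) + m)"
          unfolding exp_add by simp
        also have "\<dots> \<le> 2 * weight_const * (k / (x * k) ^ p) * exp ((\<bar>a\<bar> * T + mgf_const) + (real p * (\<bar>a\<bar> * T + \<sigma>) + (real p)\<^sup>2 * (\<sigma>\<^sup>2 * \<tau>) / 2))"
          using weight_const_pos k x ex by (intro mult_left_mono) auto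
        also have "\<dots> = ?C"
          unfolding exp_add[of "\<bar>a\<bar> * T + mgf_const"] by simp
        finally show "2 * K * exp m \<le> ?C" .
      qed
      finally show ?thesis using s t by simp
    qed
  qed
  also have "\<dots> = ennreal (2 * weight_const * exp (\<bar>a\<bar> * T + mgf_const) * k *
      exp (real p * (\<bar>a\<bar> * T + \<sigma>) + (real p)\<^sup>2 * (\<sigma>\<^sup>2 * \<tau>) / 2) / (x * k) ^ p) * ennreal T * ennreal T"
    using T by (simp add: nn_integral_cmult nn_integral_multc mult_ac)
  also have "\<dots> = ennreal (2 * T\<^sup>2 * weight_const * exp (\<bar>a\<bar> * T + mgf_const) * k *
      exp (real p * (\<bar>a\<bar> * T + \<sigma>) + (real p)\<^sup>2 * (\<sigma>\<^sup>2 * \<tau>) / 2) / (x * k) ^ p)"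
    using T weight_const_pos k x by (simp add: ennreal_mult[symmetric] power2_eq_square mult_ac)
  finally show ?thesis unfolding k_def by simp
qed

section \<open>The density of the exponential functional\<close>

lemma exp_moment_finite:
  assumes \<delta>: "\<bar>\<delta>\<bar> \<le> 1"
  shows "integrable M (\<lambda>\<omega>. LINT s:{0..T}|lborel. exp (\<delta> * (a * s + \<sigma> * B s \<omega>)))"
proof -
  let ?I = "\<lambda>\<omega>. LINT s:{0..T}|lborel. exp (\<delta> * (a * s + \<sigma> * B s \<omega>))"
  let ?g = "\<lambda>z. exp (\<delta> * (a * clamp_time (fst z) + \<sigma> * B (clamp_time (fst z)) (snd z)))"
  define C where "C = exp (\<bar>a\<bar> * T + \<sigma>\<^sup>2 * \<tau> / 2)"
  have gm: "?g \<in> borel_measurable (lborel \<Otimes>\<^sub>M M)"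
  proof -
    have "?g \<in> borel_measurable (borel \<Otimes>\<^sub>M M)" by measurable
    then show ?thesis by (simp cong: measurable_cong_sets sets_pair_measure_cong)
  qed
  have ptM: "(\<lambda>\<omega>. ?g (s, \<omega>)) \<in> borel_measurable M" for s
    by (rule measurable_compose[OF measurable_Pair1' gm]) simp
  interpret LM: pair_sigma_finite lborel M ..
  have eq: "?I \<omega> = (LINT s|lborel. indicator {0..T} s * ?g (s, \<omega>))" for \<omega>
    unfolding set_lebesgue_integral_def
    by (rule Bochner_Integration.integral_cong) (auto simp: clamp_time_id split: split_indicator)
  have "(\<lambda>\<omega>. LINT s|lborel. indicator {0..T} s * ?g (s, \<omega>)) \<in> borel_measurable M"
  proof (rule lborel.borel_measurable_lebesgue_integral)
    have "(\<lambda>x. ?g (snd x, fst x)) \<in> borel_measurable (M \<Otimes>\<^sub>M lborel)"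
      using measurable_compose[OF measurable_Pair[OF measurable_snd measurable_fst] gm] by simp
    then show "(\<lambda>(\<omega>, s). indicator {0..T} s * ?g (s, \<omega>)) \<in> borel_measurable (M \<Otimes>\<^sub>M lborel)"
      unfolding split_beta by measurable
  qed
  then have Im: "?I \<in> borel_measurable M" unfolding eq .
  have nonneg: "0 \<le> ?I \<omega>" for \<omega> unfolding set_lebesgue_integral_def
    by (rule Bochner_Integration.integral_nonneg) simp
  have "(\<integral>\<^sup>+\<omega>. ennreal (?I \<omega>) \<partial>M) = (\<integral>\<^sup>+\<omega>. (\<integral>\<^sup>+s. ennreal (?g (s, \<omega>)) * indicator {0..T} s \<partial>lborel) \<partial>M)"
    by (intro nn_integral_cong, subst ennreal_set_integral_Icc)
      (auto intro!: continuous_intros B_continuous nn_integral_cong simp: clamp_time_id split: split_indicator)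
  also have "\<dots> = (\<integral>\<^sup>+s. (\<integral>\<^sup>+\<omega>. ennreal (?g (s, \<omega>)) * indicator {0..T} s \<partial>M) \<partial>lborel)"
    using gm by (intro LM.Fubini') (simp add: split_beta)
  also have "\<dots> \<le> (\<integral>\<^sup>+s. ennreal C * indicator {0..T} s \<partial>lborel)"
  proof (rule nn_integral_mono)
    fix s :: real
    show "(\<integral>\<^sup>+\<omega>. ennreal (?g (s, \<omega>)) * indicator {0..T} s \<partial>M) \<le> ennreal C * indicator {0..T} s"
    proof (cases "s \<in> {0..T}")
      case s: True
      have Y: "(\<lambda>\<omega>. \<delta> * \<sigma> * B s \<omega>) \<in> lin_span" by (rule span_scaled[OF B_in_span[OF s]])
      have v: "cov (\<lambda>\<omega>. \<delta> * \<sigma> * B s \<omega>) (\<lambda>\<omega>. \<delta> * \<sigma> * B s \<omega>) = (\<delta> * \<sigma>)\<^sup>2 * R s s"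
        using cov_B[OF s s] by (simp add: cov_def power2_eq_square mult.assoc mult.left_commute)
      have d2: "\<delta>\<^sup>2 \<le> 1" using \<delta> by (simp add: abs_square_le_1)
      have vle: "(\<delta> * \<sigma>)\<^sup>2 * R s s \<le> \<sigma>\<^sup>2 * \<tau>"
      proof -
        have "(\<delta> * \<sigma>)\<^sup>2 \<le> 1 * \<sigma>\<^sup>2" unfolding power_mult_distrib by (rule mult_right_mono[OF d2]) simp
        then show ?thesis using R_le[OF s s] R_nonneg[of s s] s by (intro mult_mono) auto
      qed
      have drift: "\<delta> * (a * s) \<le> \<bar>a\<bar> * T"
      proof -
        have "\<bar>\<delta>\<bar> * (\<bar>a\<bar> * \<bar>s\<bar>) \<le> 1 * (\<bar>a\<bar> * T)"
          using \<delta> s by (intro mult_mono) auto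
        moreover have "\<delta> * (a * s) \<le> \<bar>\<delta>\<bar> * (\<bar>a\<bar> * \<bar>s\<bar>)" by (metis abs_ge_self abs_mult)
        ultimately show ?thesis by simp
      qed
      have "(\<integral>\<^sup>+\<omega>. ennreal (?g (s, \<omega>)) * indicator {0..T} s \<partial>M) =
          (\<integral>\<^sup>+\<omega>. ennreal (exp (\<delta> * (a * s))) * ennreal (exp (\<delta> * \<sigma> * B s \<omega>)) \<partial>M)"
        using s by (intro nn_integral_cong) (simp add: clamp_time_id ennreal_mult[symmetric] exp_add[symmetric] algebra_simps)
      also have "\<dots> = ennreal (exp (\<delta> * (a * s))) * (\<integral>\<^sup>+\<omega>. ennreal (exp (\<delta> * \<sigma> * B s \<omega>)) \<partial>M)"
        using span_measurable[OF Y] by (intro nn_integral_cmult) simp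
      also have "(\<integral>\<^sup>+\<omega>. ennreal (exp (\<delta> * \<sigma> * B s \<omega>)) \<partial>M) = ennreal (exp ((\<delta> * \<sigma>)\<^sup>2 * R s s / 2))"
        unfolding v[symmetric] span_mgf(2)[OF Y, symmetric]
        by (rule nn_integral_eq_integral[OF span_mgf(1)[OF Y]]) simp
      also have "ennreal (exp (\<delta> * (a * s))) * \<dots> \<le> ennreal C"
        unfolding C_def using drift vle by (simp add: ennreal_mult[symmetric] exp_add[symmetric])
      finally show ?thesis using s by simp
    qed simp
  qed
  also have "\<dots> = ennreal C * ennreal T" using T by (simp add: nn_integral_cmult)
  also have "\<dots> < \<infinity>" by (simp add: ennreal_mult_less_top)
  finally show ?thesis
    using Im nonneg by (intro integrableI_nonneg) auto
qed

text \<open>Both \<open>F\<close> and \<open>1 / F\<close> are integrable, the latter by Cauchy--Schwarz, and \<open>\<bar>ln F\<bar> \<le> F + 1 / F\<close>.\<close>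

lemma ln_F_integrable: "integrable M (\<lambda>\<omega>. ln (F \<omega>))"
proof (rule Bochner_Integration.integrable_bound[where f = "\<lambda>\<omega>. F \<omega> +
    (LINT s:{0..T}|lborel. exp (- 1 * (a * s + \<sigma> * B s \<omega>))) / T\<^sup>2"])
  let ?J = "\<lambda>\<omega>. LINT s:{0..T}|lborel. exp (- 1 * (a * s + \<sigma> * B s \<omega>))"
  have "integrable M F"
    using exp_moment_finite[of 1] by (simp add: F_def[abs_def] e_def)
  then show "integrable M (\<lambda>\<omega>. F \<omega> + ?J \<omega> / T\<^sup>2)"
    by (intro Bochner_Integration.integrable_add integrable_divide exp_moment_finite) auto
  show "AE \<omega> in M. norm (ln (F \<omega>)) \<le> norm (F \<omega> + ?J \<omega> / T\<^sup>2)"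
  proof (rule AE_I2)
    fix \<omega> assume \<omega>: "\<omega> \<in> space M"
    have F0: "F \<omega> > 0" by (rule F_pos[OF \<omega>])
    have "1 / (LINT s:{0..T}|lborel. 1 * e s \<omega>) \<le> (LINT s:{0..T}|lborel. 1 / e s \<omega>) / (LINT s:{0..T}|lborel. 1)\<^sup>2"
      by (rule inverse_integral_le) (use T e_pos e_continuous[OF \<omega>] in auto)
    moreover have "(LINT s:{0..T}|lborel. (1::real)) = T" unfolding set_lebesgue_integral_def using T by simp
    moreover have "1 / e s \<omega> = exp (- 1 * (a * s + \<sigma> * B s \<omega>))" for s
      unfolding e_def mult_minus_left exp_minus by (simp add: inverse_eq_divide)
    ultimately have inv: "1 / F \<omega> \<le> ?J \<omega> / T\<^sup>2" unfolding F_def by simp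
    have "ln (F \<omega>) \<le> F \<omega> - 1" using ln_le_minus_one[OF F0] .
    moreover have "- ln (F \<omega>) \<le> 1 / F \<omega> - 1"
      using ln_le_minus_one[of "1 / F \<omega>"] F0 by (simp add: ln_div)
    moreover have "1 / F \<omega> > 0" using F0 by simp
    ultimately have "\<bar>ln (F \<omega>)\<bar> \<le> F \<omega> + ?J \<omega> / T\<^sup>2"
      using inv F0 by linarith
    then show "norm (ln (F \<omega>)) \<le> norm (F \<omega> + ?J \<omega> / T\<^sup>2)" by simp
  qed
qed measurable

lemma F_density:
  obtains \<rho> c where "\<And>x. 0 \<le> \<rho> x" "distributed M lborel F (\<lambda>x. ennreal (\<rho> x))" "c > 0"
    "\<And>x. x > exp m \<Longrightarrow> \<rho> x \<le> c / x * exp (- ((ln x - m)\<^sup>2 / (2 * (\<sigma>\<^sup>2 * \<tau>))))"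
proof -
  let ?C = "2 * T\<^sup>2 * weight_const * exp (\<bar>a\<bar> * T + mgf_const)"
  have "?C > 0" "\<sigma>\<^sup>2 * \<tau> > 0" using T weight_const_pos \<sigma> tau_pos by auto
  then obtain c where c: "c > 0"
    "\<And>x. x > exp m \<Longrightarrow> \<exists>p\<ge>1. ?C * (\<beta> * real p) * exp (real p * (\<bar>a\<bar> * T + \<sigma>) + (real p)\<^sup>2 * (\<sigma>\<^sup>2 * \<tau>) / 2) / (x * (\<beta> * real p)) ^ p
        \<le> c / x * exp (- ((ln x - m)\<^sup>2 / (2 * (\<sigma>\<^sup>2 * \<tau>))))"
    using superexponential_absorbs[of ?C \<beta> "\<sigma>\<^sup>2 * \<tau>" m "\<bar>a\<bar> * T + \<sigma>"] beta_pos by blast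
  define b where "b x = c / x * exp (- ((ln x - m)\<^sup>2 / (2 * (\<sigma>\<^sup>2 * \<tau>))))" for x
  have pos: "x > 0" if "x > exp m" for x using that exp_gt_zero[of m] by linarith
  have kb: "\<kappa> x \<le> ennreal (b x)" if x: "x > exp m" for x
  proof -
    from c(2)[OF x] obtain p where p: "p \<ge> 1" and
      le: "?C * (\<beta> * real p) * exp (real p * (\<bar>a\<bar> * T + \<sigma>) + (real p)\<^sup>2 * (\<sigma>\<^sup>2 * \<tau>) / 2) / (x * (\<beta> * real p)) ^ p \<le> b x"
      unfolding b_def by blast
    show ?thesis using kappa_bound[OF pos[OF x] p] ennreal_leI[OF le] by (rule order_trans)
  qed
  have dom: "emeasure M {\<omega>\<in>space M. F \<omega> \<in> A} \<le> (\<integral>\<^sup>+x. indicator A x * \<kappa> x \<partial>lborel)" if [measurable]: "A \<in> sets borel" for A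
  proof -
    have "emeasure M {\<omega>\<in>space M. F \<omega> \<in> A} = (\<integral>\<^sup>+\<omega>. indicator {\<omega>\<in>space M. F \<omega> \<in> A} \<omega> \<partial>M)" by simp
    also have "\<dots> = (\<integral>\<^sup>+\<omega>. indicator A (F \<omega>) \<partial>M)"
      by (rule nn_integral_cong) (simp add: indicator_def)
    also have "\<dots> \<le> (\<integral>\<^sup>+x. indicator A x * \<kappa> x \<partial>lborel)" by (rule law_dominated) simp
    finally show ?thesis .
  qed
  have [measurable]: "b \<in> borel_measurable borel" unfolding b_def[abs_def] by measurable
  obtain \<rho> where "\<And>x. 0 \<le> \<rho> x" "distributed M lborel F (\<lambda>x. ennreal (\<rho> x))"
    "\<And>x. x \<in> {exp m<..} \<Longrightarrow> \<rho> x \<le> b x"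
  proof (rule density_of_dominated_law[OF F_measurable dom])
    show "0 \<le> b x" if "x \<in> {exp m<..}" for x
      unfolding b_def using that pos[of x] c(1) by simp
  qed (use kb in auto)
  then show ?thesis using that[of \<rho> c] c(1) by (simp add: b_def)
qed

end

theorem theorem3p2:
  fixes M :: "'w measure" and T a \<sigma> H :: real
    and B :: "real \<Rightarrow> 'w \<Rightarrow> real" and F :: "'w \<Rightarrow> real"
  assumes "T > 0" and "\<sigma> > 0" and "1 / 2 < H" and "H < 1"
    and "fractional_brownian_motion M T H B"
    and "F = (\<lambda>\<omega>. LINT s:{0..T}|lborel. exp (a * s + \<sigma> * B s \<omega>))"
  shows "integrable M (\<lambda>\<omega>. ln (F \<omega>)) \<and>
    (\<exists>\<rho> :: real \<Rightarrow> real.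
       (\<forall>x. 0 \<le> \<rho> x) \<and> distributed M lborel F (\<lambda>x. ennreal (\<rho> x)) \<and>
       (\<exists>c>0. \<forall>x > exp (integral\<^sup>L M (\<lambda>\<omega>. ln (F \<omega>))).
          \<rho> x \<le> c / x * exp (- ((ln x - integral\<^sup>L M (\<lambda>\<omega>. ln (F \<omega>)))\<^sup>2
                               / (2 * \<sigma>\<^sup>2 * T powr (2 * H))))))"
proof -
  interpret prob_space M using assms(5) unfolding fractional_brownian_motion_def by blast
  interpret E: exp_functional M T H B a \<sigma> by unfold_locales (use assms in auto)
  have F: "F = E.F" unfolding assms(6) E.F_def[abs_def] E.e_def ..
  obtain \<rho> c where "\<And>x. 0 \<le> \<rho> x" "distributed M lborel F (\<lambda>x. ennreal (\<rho> x))" "c > 0"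
    "\<And>x. x > exp (integral\<^sup>L M (\<lambda>\<omega>. ln (F \<omega>))) \<Longrightarrow>
      \<rho> x \<le> c / x * exp (- ((ln x - integral\<^sup>L M (\<lambda>\<omega>. ln (F \<omega>)))\<^sup>2 / (2 * (\<sigma>\<^sup>2 * E.\<tau>))))"
    unfolding F by (rule E.F_density[where m = "integral\<^sup>L M (\<lambda>\<omega>. ln (E.F \<omega>))"]) blast
  moreover have "integrable M (\<lambda>\<omega>. ln (F \<omega>))" unfolding F by (rule E.ln_F_integrable)
  ultimately show ?thesis unfolding E.\<tau>_def mult.assoc by blast
qed

end
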